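(* Let $T$ be a tree and $\mathbf{x}\in\mathbb{R}^{V(T)}$. Then $\mathbf{x}$ is a Fiedler vector of $T$ (that is, there is a weighted Laplacian matrix $A\in\mathcal{S}_L(T)$ such that $\mathbf{x}$ is an eigenvector of $A$ for $\lambda_2(A)$) if and only if $\mathbf{x}$ is Fiedler-like with respect to $T$.
   Context: Graphs are finite and simple. For a graph $G$, $\mathcal{S}_L(G)$ is the set of real symmetric matrices $A$ indexed by $V(G)$ such that for $i\ne j$ the $i,j$-entry is negative if $\{i,j\}\in E(G)$ and zero otherwise, and $A\mathbf{1}=\mathbf{0}$ ($\mathbf{1}$ the all-ones vector). Equivalently, $\mathcal{S}_L(G)$ is the set of weighted Laplacian matrices of $G$ over all assignments of positive edge weights. $\lambda_k(A)$ is the $k$-th smallest eigenvalue of $A$, counted with multiplicity. A vector is a Fiedler vector of $G$ if it is an eigenvector of some $A\in\mathcal{S}_L(G)$ with respect to $\lambda_2(A)$. Paths are simple paths. A vector $\mathbf{x}=(x_i)\in\mathbb{R}^{V(T)}$ is Fiedler-like with respect to a tree $T$ if $\mathbf{1}^\top\mathbf{x}=0$ and one of the following holds. Type I: there is exactly one vertex $i$ with $x_i=0$ that is adjacent to some vertex $j$ with $x_j\neq 0$; and for any path in $T$ starting at $i$, the values of $\mathbf{x}$ along the path are either strictly increasing, strictly decreasing, or constantly zero. Type II: there is exactly one edge $\{i,j\}$ with $x_ix_j<0$, say $x_i<0<x_j$; and for any path starting at $i$ without passing $j$, the values of $\mathbf{x}$ along the path are strictly decreasing, and for any path starting at $j$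 without passing $i$, the values of $\mathbf{x}$ along the path are strictly increasing. *)

theory Defs
  imports "HOL-Analysis.Analysis" "HOL-Computational_Algebra.Polynomial"
begin

text \<open>The vertex set of a graph is a finite type 'v, and a graph is given by its
  set of edges, so that matrices indexed by the vertices have type real ^ 'v ^ 'v.\<close>

definition simple_graph :: "'v::finite set set \<Rightarrow> bool" where
  "simple_graph E \<longleftrightarrow> (\<forall>e\<in>E. card e = 2)"

text \<open>Paths are simple, and a single vertex is a path.\<close>

definition graph_path :: "'v set set \<Rightarrow> 'v list \<Rightarrow> bool" where
  "graph_path E p \<longleftrightarrow> p \<noteq> [] \<and> distinct p \<and> successively (\<lambda>u v. {u, v} \<in> E) p"

definition graph_connected :: "'v set set \<Rightarrow> bool" where
  "graph_connected E \<longleftrightarrow> (\<forall>u v. \<exists>p. graph_path E p \<and> hd p = u \<and> last p = v)"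

definition graph_cycle :: "'v set set \<Rightarrow> 'v list \<Rightarrow> bool" where
  "graph_cycle E p \<longleftrightarrow> graph_path E p \<and> length p \<ge> 3 \<and> {last p, hd p} \<in> E"

definition is_tree :: "'v::finite set set \<Rightarrow> bool" where
  "is_tree E \<longleftrightarrow> simple_graph E \<and> graph_connected E \<and> (\<nexists>p. graph_cycle E p)"

definition weighted_laplacians :: "'v::finite set set \<Rightarrow> (real ^ 'v ^ 'v) set" where
  "weighted_laplacians E = {A. transpose A = A \<and>
     (\<forall>i j. i \<noteq> j \<longrightarrow> (if {i, j} \<in> E then A $ i $ j < 0 else A $ i $ j = 0)) \<and>
     A *v 1 = 0}"

text \<open>The characteristic polynomial is the determinant of t I - A over the polynomial ring.\<close>

definition charpoly :: "real ^ 'v ^ 'v \<Rightarrow> real poly" where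
  "charpoly A = det (mat [:0, 1:] - map_matrix (\<lambda>a. [:a:]) A)"

text \<open>The k-th smallest eigenvalue, with k counted from 1 and eigenvalues repeated according to
  their multiplicity as roots of the characteristic polynomial. It is meant for a symmetric A,
  whose eigenvalues are all real, and for k between 1 and the order of A; otherwise the
  value is not meaningful.\<close>

definition eigenvalue_nth :: "nat \<Rightarrow> real ^ 'v ^ 'v \<Rightarrow> real" where
  "eigenvalue_nth k A = sorted_list_of_multiset (proots (charpoly A)) ! (k - 1)"

definition is_eigenvector :: "real ^ 'v ^ 'v \<Rightarrow> real \<Rightarrow> real ^ 'v \<Rightarrow> bool" where
  "is_eigenvector A \<mu> x \<longleftrightarrow> x \<noteq> 0 \<and> A *v x = \<mu> *\<^sub>R x"

text \<open>The cardinality condition says that the second eigenvalue exists: a graph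
  with one vertex has no Fiedler vector.\<close>

definition fiedler_vector :: "'v::finite set set \<Rightarrow> real ^ 'v \<Rightarrow> bool" where
  "fiedler_vector E x \<longleftrightarrow>
     CARD('v) \<ge> 2 \<and> (\<exists>A\<in>weighted_laplacians E. is_eigenvector A (eigenvalue_nth 2 A) x)"

abbreviation values_along :: "real ^ 'v \<Rightarrow> 'v list \<Rightarrow> real list" where
  "values_along x p \<equiv> map (\<lambda>v. x $ v) p"

definition fiedler_like_I :: "'v::finite set set \<Rightarrow> real ^ 'v \<Rightarrow> bool" where
  "fiedler_like_I E x \<longleftrightarrow> (\<exists>i.
     {k. x $ k = 0 \<and> (\<exists>j. {k, j} \<in> E \<and> x $ j \<noteq> 0)} = {i} \<and>
     (\<forall>p. graph_path E p \<and> hd p = i \<longrightarrow>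
        sorted_wrt (<) (values_along x p) \<or>
        sorted_wrt (>) (values_along x p) \<or>
        (\<forall>v\<in>set p. x $ v = 0)))"

definition fiedler_like_II :: "'v::finite set set \<Rightarrow> real ^ 'v \<Rightarrow> bool" where
  "fiedler_like_II E x \<longleftrightarrow> (\<exists>i j.
     {{k, l} |k l. {k, l} \<in> E \<and> x $ k * x $ l < 0} = {{i, j}} \<and> x $ i < 0 \<and> 0 < x $ j \<and>
     (\<forall>p. graph_path E p \<and> hd p = i \<and> j \<notin> set p \<longrightarrow> sorted_wrt (>) (values_along x p)) \<and>
     (\<forall>p. graph_path E p \<and> hd p = j \<and> i \<notin> set p \<longrightarrow> sorted_wrt (<) (values_along x p)))"

definition fiedler_like :: "'v::finite set set \<Rightarrow> real ^ 'v \<Rightarrow> bool" where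
  "fiedler_like E x \<longleftrightarrow> 1 \<bullet> x = 0 \<and> (fiedler_like_I E x \<or> fiedler_like_II E x)"

end

theory Submission
  imports Defs
begin

text \<open>
  Let \<open>A\<close> be a weighted Laplacian of the tree. Its eigenvalue \<open>0\<close> is simple
  (\<open>charpoly_simple_zero\<close>), so \<open>\<lambda>\<^sub>2\<close> is the minimum of the Rayleigh quotient on the complement of
  the all-ones vector (\<open>eigenvalue_2_eqI\<close>, \<open>eigenvalue_2_min\<close>). Two identities then carry both
  directions of the theorem.

  The first is the conservation law \<open>cut_flow\<close>: removing an edge \<open>uv\<close> of weight \<open>c\<close> splits the tree
  into two sides, and the sum of \<open>A x\<close> over the side of \<open>v\<close> is \<open>c (x\<^sub>v - x\<^sub>u)\<close>. If \<open>A x = \<lambda> x\<close> and \<open>x\<close>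
  keeps its sign on that side, then \<open>x\<close> moves away from zero along the edge; this gives the strict
  monotonicity along paths. Read backwards, the law determines the edge weights for which a given
  vector has a given image (\<open>laplacian_with_prescribed_image\<close>), and for a Fiedler-like vector these
  weights are positive.

  The second is the ground state transform \<open>ground_state_identity\<close>: if \<open>A h = \<lambda> h\<close> and \<open>z = r h\<close>, then
  \<open>z \<bullet> A z - \<lambda> (z \<bullet> z)\<close> is the sum over the edges \<open>uv\<close> of \<open>c h\<^sub>u h\<^sub>v (r\<^sub>u - r\<^sub>v)\<^sup>2\<close>. It turns signs of \<open>h\<close>
  along edges into bounds on the Rayleigh quotient.

  From a Fiedler vector \<open>x\<close> to a Fiedler-like one: call an edge nodal if \<open>x\<^sub>u x\<^sub>v \<le> 0\<close> and \<open>x\<^sub>u \<noteq> x\<^sub>v\<close>.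
  Given two nodal edges, a suitable \<open>r\<close> that is constant on the three pieces of the tree between
  them would push the Rayleigh quotient of \<open>r x\<close> below the minimum, or make \<open>r x\<close> a second
  eigenvector that violates the eigenvalue equation at an end of a nodal edge, unless the two edges
  meet in a zero of \<open>x\<close> (\<open>nodal_edges_share_zero\<close>). So either a single edge carries the sign change, or
  all nodal edges meet in one zero vertex, which are the two types.

  From a Fiedler-like vector \<open>x\<close> to a Fiedler vector: choose the weights such that \<open>A x = x\<close>. To see
  that \<open>1\<close> is the second eigenvalue, subtract from a vector \<open>w\<close> the constant that makes it vanish where \<open>x\<close> changes
  sign (at the vertex, or at a point inside the edge). The ground state transform, with \<open>h\<close> equal to
  \<open>x\<close> up to signs, shows that the Rayleigh quotient of the result is at least \<open>1\<close>
  (\<open>ground_state_bound\<close>), and so is that of \<open>w\<close> if \<open>w\<close> sums to zero (\<open>fiedler_vectorI\<close>). In Type I the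
  branches on which \<open>x\<close> vanishes need heavy edges, and \<open>h\<close> is modified there accordingly.
\<close>

section \<open>Cutting a tree at an edge\<close>

lemma graph_path_appendD:
  assumes "graph_path E (p @ q)"
  shows "p \<noteq> [] \<Longrightarrow> graph_path E p" and "q \<noteq> [] \<Longrightarrow> graph_path E q"
  using assms by (auto simp: graph_path_def successively_append_iff)

lemma graph_path_snoc:
  assumes "graph_path E p" "{last p, w} \<in> E" "w \<notin> set p"
  shows "graph_path E (p @ [w])"
  using assms by (auto simp: graph_path_def successively_append_iff)

lemma graph_path_successivelyI:
  assumes "graph_path E p"
    and "\<And>p1 u v p2. p = p1 @ u # v # p2 \<Longrightarrow> {u, v} \<in> E \<Longrightarrow> R u v"
  shows "successively R p"
  unfolding successively_conv_nth
proof (intro allI impI)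
  fix k assume k: "Suc k < length p"
  then have "p = take k p @ p!k # p!(Suc k) # drop (Suc (Suc k)) p"
    by (metis Cons_nth_drop_Suc Suc_lessD id_take_nth_drop)
  moreover have "{p!k, p!(Suc k)} \<in> E"
    using assms(1) k by (simp add: graph_path_def successively_conv_nth)
  ultimately show "R (p!k) (p!(Suc k))" by (rule assms(2))
qed

lemma path_leaves_set:
  assumes "p \<noteq> []" "hd p \<in> S" "last p \<notin> S"
  obtains p1 a b p2 where "p = p1 @ a # b # p2" "a \<in> S" "b \<notin> S"
proof -
  have "\<exists>p1 a b p2. p = p1 @ a # b # p2 \<and> a \<in> S \<and> b \<notin> S"
    using assms
  proof (induction p)
    case (Cons c p)
    then have ne: "p \<noteq> []" by auto
    show ?case
    proof (cases "hd p \<in> S")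
      case True
      then obtain p1 a b p2 where "p = p1 @ a # b # p2" "a \<in> S" "b \<notin> S"
        using Cons ne by auto
      then have "c # p = (c # p1) @ a # b # p2" by simp
      with \<open>a \<in> S\<close> \<open>b \<notin> S\<close> show ?thesis by blast
    next
      case False
      then have "c # p = [] @ c # hd p # tl p" using ne by simp
      with False Cons.prems show ?thesis by (metis list.sel(1))
    qed
  qed simp
  with that show thesis by blast
qed

text \<open>For an edge \<open>uv\<close> of a tree this is the component of \<open>v\<close> after the edge is removed. Paths from
  \<open>v\<close> that avoid the vertex \<open>u\<close> describe it as well as paths that avoid the edge, since a path
  from \<open>v\<close> through \<open>u\<close> in a tree uses the edge.\<close>

definition side :: "'v set set \<Rightarrow> 'v \<Rightarrow> 'v \<Rightarrow> 'v set" where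
  "side E u v = {w. \<exists>p. graph_path E p \<and> hd p = v \<and> last p = w \<and> u \<notin> set p}"

locale tree =
  fixes T :: "'v::finite set set"
  assumes is_tree: "is_tree T"
begin

lemma edge_neq: "{u, v} \<in> T \<Longrightarrow> u \<noteq> v"
  using is_tree by (auto simp: is_tree_def simple_graph_def)

lemma path_exists: obtains p where "graph_path T p" "hd p = u" "last p = v"
  using is_tree unfolding is_tree_def graph_connected_def by blast

lemma side_root [simp]: "{u, v} \<in> T \<Longrightarrow> v \<in> side T u v"
  unfolding side_def
  by (auto simp: graph_path_def intro!: exI[of _ "[v]"] dest: edge_neq)

lemma not_in_side [simp]: "u \<notin> side T u v"
proof
  assume "u \<in> side T u v"
  then obtain p where "graph_path T p" "last p = u" "u \<notin> set p" unfolding side_def by blast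
  then show False using last_in_set[of p] by (simp add: graph_path_def)
qed

lemma path_within_side:
  assumes "graph_path T p" "u \<notin> set p"
  shows "set p \<subseteq> side T u (hd p)"
proof
  fix w assume "w \<in> set p"
  then obtain p1 p2 where "p = p1 @ w # p2" by (auto dest: split_list)
  then have "p = (p1 @ [w]) @ p2" by simp
  then have "graph_path T (p1 @ [w])" "hd (p1 @ [w]) = hd p" "u \<notin> set (p1 @ [w])"
    using assms graph_path_appendD[of T "p1 @ [w]" p2] by (auto simp: hd_append)
  then show "w \<in> side T u (hd p)" unfolding side_def by force
qed

text \<open>The only place where acyclicity enters: if \<open>w\<close> is on the side of \<open>v\<close> and \<open>w'\<close> is not, then
  extending a path from \<open>v\<close> to \<open>w\<close> by \<open>w'\<close> can fail to witness \<open>w'\<close> only for \<open>w' = u\<close>, and then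
  the extended path closes up to a cycle through \<open>u\<close> and \<open>v\<close> unless \<open>w = v\<close>.\<close>

lemma side_crossing:
  assumes uv: "{u, v} \<in> T" and w: "w \<in> side T u v" "w' \<notin> side T u v" "{w, w'} \<in> T"
  shows "w = v" "w' = u"
proof -
  obtain p where p: "graph_path T p" "hd p = v" "last p = w" "u \<notin> set p"
    using w(1) unfolding side_def by blast
  have "w' \<notin> set p" using path_within_side[OF p(1,4)] p(2) w(2) by auto
  then have q: "graph_path T (p @ [w'])"
    using p w(3) by (intro graph_path_snoc) auto
  show w': "w' = u"
  proof (rule ccontr)
    assume "w' \<noteq> u"
    then have "w' \<in> side T u v"
      using q p unfolding side_def by (auto intro!: exI[of _ "p @ [w']"] simp: graph_path_def)
    with w(2) show False by simp
  qed
  show "w = v"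
  proof (rule ccontr)
    assume "w \<noteq> v"
    have "p \<noteq> []" using p(1) by (simp add: graph_path_def)
    moreover have "length p \<noteq> 1" using p \<open>w \<noteq> v\<close> by (auto simp: length_Suc_conv)
    ultimately have "length (p @ [w']) \<ge> 3" by (cases p; cases "tl p") auto
    moreover have "{last (p @ [w']), hd (p @ [w'])} \<in> T"
      using p uv w' \<open>p \<noteq> []\<close> by auto
    ultimately have "graph_cycle T (p @ [w'])"
      using q unfolding graph_cycle_def by blast
    then show False using is_tree unfolding is_tree_def by blast
  qed
qed

lemma same_side:
  assumes "{u, v} \<in> T" "{a, b} \<in> T" "{a, b} \<noteq> {u, v}"
  shows "a \<in> side T u v \<longleftrightarrow> b \<in> side T u v"
  using side_crossing[OF assms(1), of a b] side_crossing[OF assms(1), of b a] assms(2,3)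
  by (auto simp: insert_commute)

text \<open>A path that changes sides has to use the cut edge, in the right direction. Together with
  its mirror image this replaces the uniqueness of paths in a tree.\<close>

lemma path_into_side:
  assumes "{u, v} \<in> T" "graph_path T p" "hd p \<notin> side T u v" "last p \<in> side T u v"
  obtains p1 p2 where "p = p1 @ u # v # p2"
proof -
  have "p \<noteq> []" using assms(2) by (simp add: graph_path_def)
  then obtain p1 a b p2 where p: "p = p1 @ a # b # p2" "a \<notin> side T u v" "b \<in> side T u v"
    using path_leaves_set[of p "- side T u v"] assms by (metis ComplD ComplI)
  moreover have "{b, a} \<in> T"
    using assms(2) p(1) by (auto simp: graph_path_def successively_append_iff insert_commute)
  ultimately have "b = v" "a = u" using side_crossing[OF assms(1), of b a] by auto
  with p that show thesis by blast
qed

lemma path_out_of_side: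
  assumes "{u, v} \<in> T" "graph_path T p" "hd p \<in> side T u v" "last p \<notin> side T u v"
  obtains p1 p2 where "p = p1 @ v # u # p2"
proof -
  have "p \<noteq> []" using assms(2) by (simp add: graph_path_def)
  then obtain p1 a b p2 where p: "p = p1 @ a # b # p2" "a \<in> side T u v" "b \<notin> side T u v"
    using path_leaves_set[of p "side T u v"] assms by metis
  moreover have "{a, b} \<in> T"
    using assms(2) p(1) by (auto simp: graph_path_def successively_append_iff)
  ultimately have "a = v" "b = u" using side_crossing[OF assms(1), of a b] by auto
  with p that show thesis by blast
qed

lemma side_swap:
  assumes uv: "{u, v} \<in> T"
  shows "side T v u = - side T u v"
proof (intro set_eqI iffI)
  fix w assume "w \<in> side T v u"
  then obtain p where p: "graph_path T p" "hd p = u" "last p = w" "v \<notin> set p"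
    unfolding side_def by blast
  show "w \<in> - side T u v"
  proof
    assume "w \<in> side T u v"
    then obtain p1 p2 where "p = p1 @ u # v # p2"
      using path_into_side[OF uv p(1)] p by auto
    with p(4) show False by simp
  qed
next
  fix w assume w: "w \<in> - side T u v"
  obtain p where p: "graph_path T p" "hd p = v" "last p = w" using path_exists .
  then obtain p1 p2 where "p = p1 @ v # u # p2"
    using path_out_of_side[OF uv p(1)] w side_root[OF uv] by auto
  then have pp: "p = (p1 @ [v]) @ (u # p2)" by simp
  then have "graph_path T (u # p2)" using graph_path_appendD p(1) by blast
  moreover have "v \<notin> set (u # p2)" "last (u # p2) = w"
    using p pp by (auto simp: graph_path_def)
  ultimately show "w \<in> side T v u" unfolding side_def by (auto intro!: exI[of _ "u # p2"])
qed

lemma sides_cover: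
  assumes "w \<noteq> u"
  obtains v where "{u, v} \<in> T" "w \<in> side T u v"
proof -
  obtain p where p: "graph_path T p" "hd p = u" "last p = w" using path_exists .
  then obtain q where q: "p = u # q" by (cases p) (auto simp: graph_path_def)
  with p assms have "q \<noteq> []" by auto
  then have "{u, hd q} \<in> T" "graph_path T q" "u \<notin> set q" "last q = w"
    using p q by (auto simp: graph_path_def successively_Cons)
  with that[of "hd q"] show thesis unfolding side_def by blast
qed

lemma sides_disjoint:
  assumes "{u, v} \<in> T" "{u, v'} \<in> T" "v \<noteq> v'"
  shows "side T u v \<inter> side T u v' = {}"
proof (rule ccontr)
  assume "side T u v \<inter> side T u v' \<noteq> {}"
  then obtain w where w: "w \<in> side T u v" "w \<in> side T u v'" by blast
  obtain p where p: "graph_path T p" "hd p = v" "last p = w" "u \<notin> set p"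
    using w(1) unfolding side_def by blast
  have "v \<notin> side T u v'"
    using side_crossing(1)[OF assms(2), of v u] assms by (auto simp: insert_commute)
  then obtain p1 p2 where "p = p1 @ u # v' # p2"
    using path_into_side[OF assms(2) p(1)] p w by auto
  with p(4) show False by simp
qed

text \<open>Every step of a path leads away from the starting point. Conversely,
  \<open>path_through_edge\<close> below realizes every edge that leads away from \<open>i\<close> by a path from \<open>i\<close>.
  These two facts translate between the conditions on paths in the definition of
  Fiedler-like vectors and conditions on single edges \<open>uv\<close> with \<open>i\<close> outside \<open>side T u v\<close>.\<close>

lemma path_start_not_in_side:
  assumes "graph_path T p" "p = p1 @ u # v # p2"
  shows "hd p \<notin> side T u v"
proof
  assume h: "hd p \<in> side T u v"
  have uv: "{u, v} \<in> T"
    using assms by (auto simp: graph_path_def successively_append_iff)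
  have "p = (p1 @ [u]) @ (v # p2)" using assms(2) by simp
  then have q: "graph_path T (p1 @ [u])" "v \<notin> set (p1 @ [u])" "hd (p1 @ [u]) = hd p"
    using assms(1) graph_path_appendD(1)[of T "p1 @ [u]" "v # p2"]
    by (auto simp: graph_path_def hd_append)
  then obtain q1 q2 where "p1 @ [u] = q1 @ v # u # q2"
    using path_out_of_side[OF uv q(1)] h by auto
  then have "v \<in> set (p1 @ [u])" by (metis in_set_conv_decomp)
  with q(2) show False by simp
qed

lemma constant_if_edge_constant:
  assumes "\<And>u v. {u, v} \<in> T \<Longrightarrow> f u = f v"
  shows "f a = f b"
proof (rule ccontr)
  assume ne: "f a \<noteq> f b"
  obtain p where p: "graph_path T p" "hd p = a" "last p = b" using path_exists .
  have "p \<noteq> []" using p(1) by (simp add: graph_path_def)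
  moreover have "hd p \<in> {c. f c = f a}" "last p \<notin> {c. f c = f a}" using p ne by auto
  ultimately obtain p1 u v p2 where q: "p = p1 @ u # v # p2" "f u = f a" "f v \<noteq> f a"
    by (rule path_leaves_set) blast
  then have "{u, v} \<in> T" using p(1) by (auto simp: graph_path_def successively_append_iff)
  from assms[OF this] q show False by simp
qed

lemma path_through_edge:
  assumes "{u, v} \<in> T" "i \<notin> side T u v" "w \<in> side T u v"
  obtains p p1 p2 where "graph_path T p" "hd p = i" "last p = w" "p = p1 @ u # v # p2"
  using assms path_into_side path_exists by metis

end

section \<open>Quadratic forms of weighted Laplacians\<close>

lemma inner_matrix_vector:
  fixes A :: "real^'v^'v::finite"
  shows "y \<bullet> (A *v x) = (\<Sum>a\<in>UNIV. \<Sum>b\<in>UNIV. A$a$b * (y$a * x$b))"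
  by (simp add: inner_vec_def matrix_vector_mult_def sum_distrib_left mult_ac)

lemma symmetric_inner:
  fixes A :: "real^'v^'v::finite"
  assumes "transpose A = A"
  shows "y \<bullet> (A *v x) = (A *v y) \<bullet> x"
  by (metis assms dot_lmul_matrix transpose_matrix_vector)

lemma symmetric_entries:
  assumes "transpose A = A"
  shows "A$a$b = A$b$a"
proof -
  have "transpose A $ a $ b = A$b$a" by (simp add: transpose_def)
  with assms show ?thesis by simp
qed

text \<open>The ground state transform (Jacobi's substitution), in bilinear form. Writing a vector as
  \<open>r\<close> times \<open>h\<close> moves the diagonal of \<open>A\<close> into the values \<open>A h\<close>; what is left only sees the
  differences of \<open>r\<close> along edges, with a sign given by the signs of \<open>h\<close>. The identity is
  \<open>2 s\<^sub>a r\<^sub>b = s\<^sub>a r\<^sub>a + s\<^sub>b r\<^sub>b - (s\<^sub>a - s\<^sub>b) (r\<^sub>a - r\<^sub>b) + (s\<^sub>a r\<^sub>b - s\<^sub>b r\<^sub>a)\<close>, whose last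
  part cancels by symmetry.\<close>

lemma ground_state_identity:
  fixes A :: "real^'v^'v::finite" and h :: "real^'v"
  assumes sym: "transpose A = A"
  shows "(\<chi> a. s a * h$a) \<bullet> (A *v (\<chi> a. r a * h$a))
       = (\<Sum>a\<in>UNIV. s a * r a * h$a * (A *v h)$a)
         - (\<Sum>a\<in>UNIV. \<Sum>b\<in>UNIV. A$a$b * (h$a * h$b) * ((s a - s b) * (r a - r b))) / 2"
proof -
  define F where "F g = (\<Sum>a\<in>UNIV. \<Sum>b\<in>UNIV. A$a$b * (h$a * h$b) * g a b)" for g :: "'v \<Rightarrow> 'v \<Rightarrow> real"
  have swap: "F g = F (\<lambda>a b. g b a)" for g
    unfolding F_def
    by (subst sum.swap) (auto intro!: sum.cong simp: symmetric_entries[OF sym] mult_ac)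
  have diag: "F (\<lambda>a b. s a * r a) = (\<Sum>a\<in>UNIV. s a * r a * h$a * (A *v h)$a)"
    by (simp add: F_def matrix_vector_mult_def sum_distrib_left mult_ac)
  have "F (\<lambda>a b. (s a - s b) * (r a - r b))
      = F (\<lambda>a b. s a * r a) + F (\<lambda>a b. s b * r b) - F (\<lambda>a b. s a * r b) - F (\<lambda>a b. s b * r a)"
    unfolding F_def by (simp add: algebra_simps sum.distrib sum_subtractf)
  also have "\<dots> = 2 * F (\<lambda>a b. s a * r a) - 2 * F (\<lambda>a b. s a * r b)"
    using swap[of "\<lambda>a b. s a * r a"] swap[of "\<lambda>a b. s a * r b"] by simp
  finally have "F (\<lambda>a b. s a * r b)
      = F (\<lambda>a b. s a * r a) - F (\<lambda>a b. (s a - s b) * (r a - r b)) / 2" by linarith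
  moreover have "(\<chi> a. s a * h$a) \<bullet> (A *v (\<chi> a. r a * h$a)) = F (\<lambda>a b. s a * r b)"
    by (simp add: inner_matrix_vector F_def mult_ac)
  ultimately show ?thesis unfolding diag by (simp add: F_def)
qed

lemma laplacianD:
  assumes "A \<in> weighted_laplacians E"
  shows "transpose A = A" "A *v 1 = 0" "A$a$b = A$b$a"
    and "a \<noteq> b \<Longrightarrow> {a, b} \<in> E \<Longrightarrow> A$a$b < 0"
    and "a \<noteq> b \<Longrightarrow> {a, b} \<notin> E \<Longrightarrow> A$a$b = 0"
proof -
  show sym: "transpose A = A" and "A *v 1 = 0"
    using assms by (auto simp: weighted_laplacians_def)
  show "A$a$b = A$b$a" by (rule symmetric_entries[OF sym])
  have "a \<noteq> b \<Longrightarrow> if {a, b} \<in> E then A$a$b < 0 else A$a$b = 0"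
    using assms by (simp add: weighted_laplacians_def)
  then show "a \<noteq> b \<Longrightarrow> {a, b} \<in> E \<Longrightarrow> A$a$b < 0" "a \<noteq> b \<Longrightarrow> {a, b} \<notin> E \<Longrightarrow> A$a$b = 0"
    by auto
qed

lemma laplacian_form:
  fixes A :: "real^'v^'v::finite"
  assumes A: "A \<in> weighted_laplacians E"
  shows "y \<bullet> (A *v x) = - (\<Sum>a\<in>UNIV. \<Sum>b\<in>UNIV. A$a$b * ((y$a - y$b) * (x$a - x$b))) / 2"
  using ground_state_identity[OF laplacianD(1)[OF A], of "\<lambda>a. y$a" 1 "\<lambda>a. x$a"]
  by (simp add: laplacianD(2)[OF A])

lemma laplacian_form_term_nonneg:
  assumes A: "A \<in> weighted_laplacians E"
  shows "- A$a$b * (x$a - x$b)\<^sup>2 \<ge> 0"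
  using laplacianD(4,5)[OF A, of a b] by (cases "a = b"; cases "{a,b} \<in> E") (auto simp: mult_nonpos_nonneg)

lemma laplacian_eigenvector_sum:
  fixes A :: "real^'v^'v::finite"
  assumes A: "A \<in> weighted_laplacians E" and x: "A *v x = \<mu> *\<^sub>R x" and "\<mu> \<noteq> 0"
  shows "1 \<bullet> x = 0"
proof -
  have "1 \<bullet> (A *v x) = 0"
    using symmetric_inner[OF laplacianD(1)[OF A], of 1 x] laplacianD(2)[OF A] by simp
  with x \<open>\<mu> \<noteq> 0\<close> show ?thesis by simp
qed

context tree
begin

text \<open>The quadratic form is a sum of nonnegative multiples of the squared differences along the edges, so that it
  vanishes only on vectors that are constant on every edge, hence everywhere.\<close>

lemma laplacian_kernel:
  assumes A: "A \<in> weighted_laplacians T" and z: "z \<bullet> (A *v z) \<le> 0"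
  shows "z$a = z$b"
proof -
  have "(\<Sum>a\<in>UNIV. \<Sum>b\<in>UNIV. - A$a$b * (z$a - z$b)\<^sup>2) \<le> 0"
    using z unfolding laplacian_form[OF A] by (simp add: power2_eq_square sum_negf)
  then have "(\<Sum>a\<in>UNIV. \<Sum>b\<in>UNIV. - A$a$b * (z$a - z$b)\<^sup>2) = 0"
    by (intro antisym sum_nonneg laplacian_form_term_nonneg[OF A])
  then have 0: "- A$a$b * (z$a - z$b)\<^sup>2 = 0" for a b
    using laplacian_form_term_nonneg[OF A, of _ _ z]
    by (subst (asm) sum_nonneg_eq_0_iff) (auto simp: sum_nonneg_eq_0_iff sum_nonneg)
  have "z$u = z$v" if "{u, v} \<in> T" for u v
    using 0[of u v] laplacianD(4)[OF A edge_neq[OF that] that] by auto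
  then show ?thesis by (rule constant_if_edge_constant)
qed

lemma kernel_sum_zero:
  assumes A: "A \<in> weighted_laplacians T" and z: "z \<bullet> (A *v z) \<le> 0" "1 \<bullet> z = 0"
  shows "z = 0"
proof -
  have c: "z$b = z$a" for a b using laplacian_kernel[OF A z(1)] .
  have "of_nat CARD('v) * z$a = 0" for a
  proof -
    have "(\<Sum>b\<in>UNIV. z$b) = (\<Sum>b::'v\<in>UNIV. z$a)" by (intro sum.cong c refl)
    then show ?thesis using z(2) by (simp add: inner_vec_def)
  qed
  then show ?thesis by (simp add: vec_eq_iff)
qed

text \<open>Pairing \<open>A x\<close> with the indicator of one side of a cut leaves the contribution of the cut
  edge alone. For an eigenvector this ties the difference of \<open>x\<close> along the edge to the sum of \<open>x\<close>
  on a side.\<close>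

lemma cut_flow:
  assumes A: "A \<in> weighted_laplacians T" and uv: "{u, v} \<in> T"
  shows "(\<Sum>a\<in>side T u v. (A *v x)$a) = - A$u$v * (x$v - x$u)"
proof -
  define D where "D = side T u v"
  define f where "f = (\<lambda>(a, b). A$a$b * ((of_bool (a \<in> D) - of_bool (b \<in> D)) * (x$a - x$b)))"
  have D: "v \<in> D" "u \<notin> D" using uv by (simp_all add: D_def)
  have f0: "f (a, b) = 0" if "(a, b) \<notin> {(u, v), (v, u)}" for a b
  proof (cases "{a, b} \<in> T")
    case True
    then have "a \<in> D \<longleftrightarrow> b \<in> D"
      using that side_crossing[OF uv, of a b] side_crossing[OF uv, of b a]
      unfolding D_def by (auto simp: insert_commute)
    then show ?thesis by (simp add: f_def)
  next
    case False
    then show ?thesis using laplacianD(5)[OF A, of a b] by (cases "a = b") (auto simp: f_def)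
  qed
  have "(\<Sum>a\<in>D. (A *v x)$a) = (\<chi> a. of_bool (a \<in> D)) \<bullet> (A *v x)"
    by (simp add: inner_vec_def if_distrib[of "\<lambda>c. c * _"] of_bool_def sum.If_cases)
  also have "\<dots> = - (\<Sum>p\<in>UNIV. f p) / 2"
    unfolding laplacian_form[OF A] f_def UNIV_Times_UNIV[symmetric] sum.cartesian_product by simp
  also have "(\<Sum>p\<in>UNIV. f p) = (\<Sum>p\<in>{(u, v), (v, u)}. f p)"
    using f0 by (intro sum.mono_neutral_right) auto
  also have "\<dots> = f (u, v) + f (v, u)"
    using edge_neq[OF uv] by simp
  also have "\<dots> = 2 * (A$u$v * (x$v - x$u))"
    using D laplacianD(3)[OF A, of u v] by (simp add: f_def algebra_simps)
  finally show ?thesis by (simp add: D_def)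
qed

end

section \<open>The second eigenvalue\<close>

lemma linear_term_zero:
  fixes a b :: real
  assumes "\<And>t. 0 \<le> 2 * t * a + t\<^sup>2 * b"
  shows "a = 0"
proof (rule ccontr)
  assume "a \<noteq> 0"
  define c where "c = \<bar>b\<bar> + 1"
  have c: "c > 0" "b < c" by (auto simp: c_def)
  have "2 * (- a / c) * a + (- a / c)\<^sup>2 * b = a\<^sup>2 / c * (b / c - 2)"
    using c by (simp add: field_simps power2_eq_square)
  also have "\<dots> < 0"
    using c \<open>a \<noteq> 0\<close> by (intro mult_pos_neg) (auto simp: field_simps)
  finally show False using assms[of "- a / c"] by simp
qed

text \<open>Let \<open>Q(z) = z \<bullet> A z - \<mu> (z \<bullet> z)\<close>. On the complement of the all-ones vector \<open>Q\<close> is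
  nonnegative, so it is stationary where it vanishes; the perturbation in the direction
  \<open>w = A z - \<mu> z\<close> itself shows \<open>w \<bullet> w = 0\<close>.\<close>

lemma constrained_minimizer_is_eigenvector:
  fixes A :: "real^'v^'v::finite"
  assumes sym: "transpose A = A" and rows: "A *v 1 = 0"
    and min: "\<And>w. 1 \<bullet> w = 0 \<Longrightarrow> \<mu> * (w \<bullet> w) \<le> w \<bullet> (A *v w)"
    and z: "1 \<bullet> z = 0" "z \<bullet> (A *v z) \<le> \<mu> * (z \<bullet> z)"
  shows "A *v z = \<mu> *\<^sub>R z"
proof -
  define w where "w = A *v z - \<mu> *\<^sub>R z"
  have w0: "1 \<bullet> w = 0"
    using symmetric_inner[OF sym, of 1 z] rows z(1) by (simp add: w_def inner_diff_right)
  have "0 \<le> 2 * t * (w \<bullet> w) + t\<^sup>2 * (w \<bullet> (A *v w) - \<mu> * (w \<bullet> w))" for t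
  proof -
    have "\<mu> * ((z + t *\<^sub>R w) \<bullet> (z + t *\<^sub>R w)) \<le> (z + t *\<^sub>R w) \<bullet> (A *v (z + t *\<^sub>R w))"
      using z(1) w0 by (intro min) (simp add: inner_add_right)
    also have "\<dots> = z \<bullet> (A *v z) + 2 * t * (w \<bullet> (A *v z)) + t\<^sup>2 * (w \<bullet> (A *v w))"
      using symmetric_inner[OF sym, of z w]
      by (simp add: matrix_vector_right_distrib matrix_vector_mult_scaleR inner_add_left
          inner_add_right inner_commute algebra_simps power2_eq_square)
    finally have "0 \<le> 2 * t * (w \<bullet> (A *v z) - \<mu> * (w \<bullet> z)) + t\<^sup>2 * (w \<bullet> (A *v w) - \<mu> * (w \<bullet> w))"
      using z(2) by (simp add: inner_add_left inner_add_right inner_commute algebra_simps power2_eq_square)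
    also have "w \<bullet> (A *v z) - \<mu> * (w \<bullet> z) = w \<bullet> w"
      by (simp add: w_def inner_diff_right)
    finally show ?thesis .
  qed
  then have "w \<bullet> w = 0" by (rule linear_term_zero)
  then show ?thesis by (simp add: w_def)
qed

lemma constrained_minimizer_exists:
  fixes A :: "real^'v^'v::finite"
  assumes "CARD('v) \<ge> 2"
  obtains y \<mu> where "y \<noteq> 0" "1 \<bullet> y = 0" "y \<bullet> (A *v y) = \<mu> * (y \<bullet> y)"
    "\<And>w. 1 \<bullet> w = 0 \<Longrightarrow> \<mu> * (w \<bullet> w) \<le> w \<bullet> (A *v w)"
proof -
  define K where "K = sphere 0 1 \<inter> {z :: real^'v. 1 \<bullet> z = 0}"
  have "compact K"
    unfolding K_def by (intro compact_Int_closed compact_sphere closed_hyperplane)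
  obtain a b :: 'v where ab: "a \<noteq> b"
    using assms by (metis One_nat_def card_le_Suc0_iff_eq finite_class.finite_UNIV not_less_eq_eq numeral_2_eq_2 UNIV_I)
  define z where "z = axis a 1 - axis b (1::real)"
  have "z \<noteq> 0" using ab by (auto simp: z_def axis_eq_axis)
  moreover have "1 \<bullet> z = 0" by (simp add: z_def inner_diff_right inner_axis)
  ultimately have "z /\<^sub>R norm z \<in> K" by (simp add: K_def)
  then have "K \<noteq> {}" by auto
  have "continuous_on K (\<lambda>z. z \<bullet> (A *v z))"
    by (intro continuous_intros linear_continuous_on matrix_vector_mul_bounded_linear)
  from continuous_attains_inf[OF \<open>compact K\<close> \<open>K \<noteq> {}\<close> this]
  obtain y where y: "y \<in> K" "\<And>w. w \<in> K \<Longrightarrow> y \<bullet> (A *v y) \<le> w \<bullet> (A *v w)" by blast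
  define \<mu> where "\<mu> = y \<bullet> (A *v y)"
  have yy: "y \<bullet> y = 1" using y(1) by (simp add: K_def dot_square_norm)
  show thesis
  proof (rule that[of y \<mu>])
    show "y \<noteq> 0" "1 \<bullet> y = 0" "y \<bullet> (A *v y) = \<mu> * (y \<bullet> y)"
      using yy y(1) by (auto simp: K_def \<mu>_def)
  next
    fix w :: "real^'v" assume w: "1 \<bullet> w = 0"
    show "\<mu> * (w \<bullet> w) \<le> w \<bullet> (A *v w)"
    proof (cases "w = 0")
      case False
      then have "w /\<^sub>R norm w \<in> K" using w by (simp add: K_def)
      then have "\<mu> \<le> (w \<bullet> (A *v w)) / (norm w)\<^sup>2"
        using y(2)[of "w /\<^sub>R norm w"] False
        by (simp add: \<mu>_def matrix_vector_mult_scaleR power2_eq_square divide_inverse mult_ac)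
      then show ?thesis using False by (simp add: dot_square_norm pos_le_divide_eq)
    qed simp
  qed
qed

lemma poly_det: "poly (det M) t = det (map_matrix (\<lambda>p. poly p t) M)"
  by (simp add: det_def poly_sum poly_prod map_matrix_def)

lemma mat_diff_mult: "(mat t - A) *v y = t *\<^sub>R y - A *v y" for A :: "real^'v^'v::finite"
proof -
  have "mat t *v y = t *\<^sub>R y"
    by (simp add: vec_eq_iff matrix_vector_mult_def mat_def if_distrib[of "\<lambda>c. c * _"] cong: if_cong)
  then show ?thesis by (simp add: matrix_vector_mult_diff_rdistrib)
qed

lemma poly_charpoly: "poly (charpoly A) t = det (mat t - A)"
proof -
  have "map_matrix (\<lambda>p. poly p t) (mat [:0, 1:] - map_matrix (\<lambda>a. [:a:]) A) = mat t - A"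
    by (simp add: vec_eq_iff map_matrix_def mat_def)
  then show ?thesis by (simp add: charpoly_def poly_det)
qed

lemma det_eq_0_iff_kernel: "det B = 0 \<longleftrightarrow> (\<exists>y. y \<noteq> 0 \<and> B *v y = 0)"
  for B :: "real^'v^'v::finite"
  using invertible_det_nz[of B] invertible_left_inverse[of B] matrix_left_invertible_ker[of B] by auto

lemma charpoly_root_iff: "poly (charpoly A) t = 0 \<longleftrightarrow> (\<exists>y. is_eigenvector A t y)"
  by (auto simp: poly_charpoly det_eq_0_iff_kernel mat_diff_mult is_eigenvector_def)

text \<open>Adding all other rows of \<open>t I - A\<close> to the row \<open>k0\<close> makes that row constantly \<open>t\<close>, because the
  columns of \<open>A\<close> sum to zero. The remaining determinant is nonzero at \<open>t = 0\<close> for a connected graph, which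
  gives the multiplicity of the eigenvalue \<open>0\<close> as a root without any diagonalization.\<close>

lemma det_mat_diff_factor:
  fixes A :: "real^'v^'v::finite"
  assumes sym: "transpose A = A" and rows: "A *v 1 = 0"
  shows "det (mat t - A) = t * det (\<chi> k. if k = k0 then 1 else row k (mat t - A))"
proof -
  define B where "B = mat t - A"
  define s where "s = (\<Sum>j\<in>-{k0}. row j B)"
  have "s \<in> vec.span {row j B |j. j \<noteq> k0}"
    unfolding s_def by (intro vec.span_sum vec.span_base) auto
  from det_row_span[OF this]
  have "det B = det (\<chi> k. if k = k0 then row k0 B + s else row k B)" ..
  also have "row k0 B + s = (\<Sum>j\<in>UNIV. row j B)"
    unfolding s_def using sum.remove[of UNIV k0 "\<lambda>j. row j B"] by (simp add: Compl_eq_Diff_UNIV)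
  also have "\<dots> = t *s 1"
  proof -
    have "(\<Sum>j\<in>UNIV. A$j$i) = 0" for i
    proof -
      have "(\<Sum>j\<in>UNIV. A$j$i) = (\<Sum>j\<in>UNIV. A$i$j)"
        by (intro sum.cong symmetric_entries[OF sym] refl)
      then show ?thesis using rows by (simp add: vec_eq_iff matrix_vector_mult_def)
    qed
    then show ?thesis
      by (simp add: vec_eq_iff B_def row_def mat_def sum_subtractf sum.delta)
  qed
  finally show ?thesis unfolding det_row_mul B_def .
qed

context tree
begin

text \<open>The cofactor at \<open>t = 0\<close> is the determinant of \<open>- A\<close> with one row replaced by ones. A vector
  in its kernel sums to zero and is mapped by \<open>A\<close> to a vector that vanishes in all but one entry;
  the entries of that image also sum to zero, so the vector lies in the kernel of \<open>A\<close> and is constant.\<close>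

lemma charpoly_simple_zero:
  assumes A: "A \<in> weighted_laplacians T"
  obtains q where "proots (charpoly A) = add_mset 0 (proots q)" "q \<noteq> 0" "poly q 0 \<noteq> 0"
    "\<And>t. poly (charpoly A) t = t * poly q t"
proof -
  fix k0 :: 'v
  define M where "M t = (\<chi> k. if k = k0 then 1 else row k (mat t - A))" for t
  note fac = det_mat_diff_factor[OF laplacianD(1,2)[OF A], where ?k0.0 = k0, folded M_def]
  have "poly (charpoly A) 0 = 0" using fac[of 0] by (simp add: poly_charpoly)
  then obtain q where q: "charpoly A = [:0, 1:] * q"
    using poly_eq_0_iff_dvd[of "charpoly A" 0] by auto
  then have pq: "poly (charpoly A) t = t * poly q t" for t by simp
  have "((\<lambda>t. M t $ i $ j) \<longlongrightarrow> M 0 $ i $ j) (at 0)" for i j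
    by (cases "i = k0"; cases "i = j") (auto simp: M_def row_def mat_def intro!: tendsto_eq_intros)
  then have "((\<lambda>t. det (M t)) \<longlongrightarrow> det (M 0)) (at 0)"
    unfolding det_def by (intro tendsto_sum tendsto_mult tendsto_const tendsto_prod)
  moreover have "\<forall>\<^sub>F t in at 0. det (M t) = poly q t"
    using pq fac by (auto simp: eventually_at_filter poly_charpoly intro!: always_eventually)
  ultimately have "(poly q \<longlongrightarrow> det (M 0)) (at 0)"
    using tendsto_cong by fast
  moreover have "(poly q \<longlongrightarrow> poly q 0) (at 0)" using poly_isCont[of 0 q] by (simp add: isCont_def)
  ultimately have q0: "poly q 0 = det (M 0)" using LIM_unique by blast
  have "det (M 0) \<noteq> 0"
  proof
    assume "det (M 0) = 0"
    then obtain y where y: "y \<noteq> 0" "M 0 *v y = 0" by (auto simp: det_eq_0_iff_kernel)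
    have 1: "1 \<bullet> y = 0"
      using y(2)[unfolded vec_eq_iff, rule_format, of k0]
      by (simp add: M_def matrix_vector_mult_def inner_vec_def)
    have k: "(A *v y)$k = 0" if "k \<noteq> k0" for k
      using y(2)[unfolded vec_eq_iff, rule_format, of k] that
      by (simp add: M_def matrix_vector_mult_def row_def mat_def sum_negf)
    have "(\<Sum>k\<in>UNIV. (A *v y)$k) = 0"
      using symmetric_inner[OF laplacianD(1)[OF A], of 1 y] laplacianD(2)[OF A]
      by (simp add: inner_vec_def)
    then have "(A *v y)$k0 = 0" using k by (simp add: sum.remove[of UNIV k0])
    with k have "A *v y = 0" by (metis vec_eq_iff zero_index)
    then show False using kernel_sum_zero[OF A _ 1] y(1) by simp
  qed
  with q0 have "poly q 0 \<noteq> 0" by simp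
  moreover from this have "q \<noteq> 0" by auto
  moreover from this have "proots (charpoly A) = add_mset 0 (proots q)"
    unfolding q by (subst proots_mult) (use proots_linear_factor[of "0::real"] in auto)
  ultimately show thesis using that pq by blast
qed

text \<open>The smallest eigenvalue \<open>0\<close> occurs once, and eigenvectors for the others are orthogonal to the
  all-ones vector; so the second entry of the sorted list of roots is the minimum of the Rayleigh
  quotient on that complement, as soon as the minimum is attained by an eigenvector.\<close>

lemma eigenvalue_2_eqI:
  assumes A: "A \<in> weighted_laplacians T"
    and y: "y \<noteq> 0" "1 \<bullet> y = 0" "A *v y = \<mu> *\<^sub>R y"
    and min: "\<And>w. 1 \<bullet> w = 0 \<Longrightarrow> \<mu> * (w \<bullet> w) \<le> w \<bullet> (A *v w)"
  shows "eigenvalue_nth 2 A = \<mu>" "\<mu> > 0"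
proof -
  show "\<mu> > 0"
  proof (rule ccontr)
    assume "\<not> \<mu> > 0"
    then have "y \<bullet> (A *v y) \<le> 0" using y(3) by (simp add: mult_nonpos_nonneg)
    with kernel_sum_zero[OF A] y show False by blast
  qed
  obtain q where q: "proots (charpoly A) = add_mset 0 (proots q)" "q \<noteq> 0" "poly q 0 \<noteq> 0"
    "\<And>t. poly (charpoly A) t = t * poly q t"
    using charpoly_simple_zero[OF A] by blast
  have "poly (charpoly A) \<mu> = 0"
    using y by (auto simp: charpoly_root_iff is_eigenvector_def)
  then have "\<mu> \<in># proots q" using q \<open>\<mu> > 0\<close> by simp
  then obtain R where R: "proots q = add_mset \<mu> R" by (metis mset_add)
  have ge: "\<mu> \<le> t" if "t \<in># proots q" for t
  proof -
    have "poly q t = 0" using that q(2) by simp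
    then have "t \<noteq> 0" "poly (charpoly A) t = 0" using q by auto
    then obtain w where w: "w \<noteq> 0" "A *v w = t *\<^sub>R w"
      by (auto simp: charpoly_root_iff is_eigenvector_def)
    then have "\<mu> * (w \<bullet> w) \<le> t * (w \<bullet> w)"
      using min[OF laplacian_eigenvector_sum[OF A w(2) \<open>t \<noteq> 0\<close>]] by simp
    then show ?thesis using w(1) by simp
  qed
  have nonneg: "0 \<le> t" if "t \<in># proots q" for t using ge[OF that] \<open>\<mu> > 0\<close> by simp
  have "sorted_list_of_multiset (proots q) = \<mu> # sorted_list_of_multiset R"
    unfolding R using ge R by (auto intro!: insort_is_Cons)
  moreover have "sorted_list_of_multiset (proots (charpoly A)) = 0 # sorted_list_of_multiset (proots q)"
    unfolding q(1) using nonneg by (auto intro!: insort_is_Cons)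
  ultimately show "eigenvalue_nth 2 A = \<mu>" by (simp add: eigenvalue_nth_def)
qed

lemma eigenvalue_2_min:
  assumes A: "A \<in> weighted_laplacians T" and card: "CARD('v) \<ge> 2"
  shows "eigenvalue_nth 2 A > 0"
    and "1 \<bullet> w = 0 \<Longrightarrow> eigenvalue_nth 2 A * (w \<bullet> w) \<le> w \<bullet> (A *v w)"
proof -
  obtain y \<mu> where y: "y \<noteq> 0" "1 \<bullet> y = 0" "y \<bullet> (A *v y) = \<mu> * (y \<bullet> y)"
    "\<And>w. 1 \<bullet> w = 0 \<Longrightarrow> \<mu> * (w \<bullet> w) \<le> w \<bullet> (A *v w)"
    using constrained_minimizer_exists[OF card] by blast
  have "A *v y = \<mu> *\<^sub>R y"
    using constrained_minimizer_is_eigenvector[OF laplacianD(1,2)[OF A] y(4) y(2)] y(3) by simp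
  note * = eigenvalue_2_eqI[OF A y(1,2) this y(4)]
  show "eigenvalue_nth 2 A > 0" using * by simp
  show "1 \<bullet> w = 0 \<Longrightarrow> eigenvalue_nth 2 A * (w \<bullet> w) \<le> w \<bullet> (A *v w)"
    using *(1) y(4) by simp
qed

end

section \<open>Fiedler vectors are Fiedler-like\<close>

lemma sum_sgn_constant:
  fixes f :: "'a \<Rightarrow> real"
  assumes "finite D" "v \<in> D" "\<And>w. w \<in> D \<Longrightarrow> sgn (f w) = sgn (f v)"
  shows "sgn (\<Sum>w\<in>D. f w) = sgn (f v)"
proof (cases "f v" "0::real" rule: linorder_cases)
  case less
  then have "f w < 0" if "w \<in> D" for w using assms(3)[OF that] by (simp add: sgn_if split: if_splits)
  then have "(\<Sum>w\<in>D. - f w) > 0" using assms(1,2) by (intro sum_pos) auto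
  with less show ?thesis by (simp add: sum_negf)
next
  case equal
  then have "f w = 0" if "w \<in> D" for w using assms(3)[OF that] by (simp add: sgn_if split: if_splits)
  with equal show ?thesis by simp
next
  case greater
  then have "f w > 0" if "w \<in> D" for w using assms(3)[OF that] by (simp add: sgn_if split: if_splits)
  then have "(\<Sum>w\<in>D. f w) > 0" using assms(1,2) by (intro sum_pos) auto
  with greater show ?thesis by simp
qed

context tree
begin

text \<open>An edge on which the sign changes, where the change from zero to nonzero counts as well.\<close>

definition nodal :: "real^'v \<Rightarrow> 'v \<Rightarrow> 'v \<Rightarrow> bool" where
  "nodal x u v \<longleftrightarrow> {u, v} \<in> T \<and> x$u * x$v \<le> 0 \<and> x$u \<noteq> x$v"

lemma nodal_commute: "nodal x u v \<longleftrightarrow> nodal x v u"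
  by (auto simp: nodal_def insert_commute mult.commute)

lemma sgn_eq_if_not_nodal:
  "{u, v} \<in> T \<Longrightarrow> \<not> nodal x u v \<Longrightarrow> sgn (x$u) = sgn (x$v)"
  by (auto simp: nodal_def not_le zero_less_mult_iff)

lemma sgn_constant_on_side:
  assumes "\<And>a b. nodal x a b \<Longrightarrow> a \<notin> side T u v \<or> b \<notin> side T u v"
    and w: "w \<in> side T u v"
  shows "sgn (x$w) = sgn (x$v)"
proof (rule ccontr)
  assume ne: "sgn (x$w) \<noteq> sgn (x$v)"
  obtain p where p: "graph_path T p" "hd p = v" "last p = w" "u \<notin> set p"
    using w unfolding side_def by blast
  have "p \<noteq> []" using p(1) by (simp add: graph_path_def)
  moreover have "hd p \<in> {a. sgn (x$a) = sgn (x$v)}" "last p \<notin> {a. sgn (x$a) = sgn (x$v)}"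
    using p ne by auto
  ultimately obtain p1 a b p2
    where q: "p = p1 @ a # b # p2" "sgn (x$a) = sgn (x$v)" "sgn (x$b) \<noteq> sgn (x$v)"
    by (rule path_leaves_set) blast
  have "{a, b} \<in> T" using p(1) q(1) by (auto simp: graph_path_def successively_append_iff)
  then have "nodal x a b" using sgn_eq_if_not_nodal q(2,3) by metis
  moreover have "a \<in> side T u v" "b \<in> side T u v"
    using path_within_side[OF p(1,4)] p(2) q(1) by auto
  ultimately show False using assms(1) by blast
qed

end

text \<open>A solution of the eigenvalue equation for a number \<open>\<mu>\<close> that bounds the Rayleigh quotient from
  below on the complement of the all-ones vector. A nonzero solution shows that \<open>\<mu>\<close> is the minimum.\<close>

locale fiedler_pair = tree T for T :: "'v::finite set set" +
  fixes A :: "real^'v^'v" and \<mu> :: real and x :: "real^'v"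
  assumes A: "A \<in> weighted_laplacians T" and \<mu>: "\<mu> > 0"
    and eigen: "A *v x = \<mu> *\<^sub>R x"
    and min: "\<And>w. 1 \<bullet> w = 0 \<Longrightarrow> \<mu> * (w \<bullet> w) \<le> w \<bullet> (A *v w)"
begin

lemma side_sum: "{u, v} \<in> T \<Longrightarrow> \<mu> * (\<Sum>a\<in>side T u v. x$a) = - A$u$v * (x$v - x$u)"
  using cut_flow[OF A, of u v x] by (simp add: eigen sum_distrib_left)

text \<open>The heart of this direction. Cut the tree at both nodal edges and rescale \<open>x\<close> by a function
  \<open>r\<close> that is constant on the pieces, with coefficients chosen such that \<open>z = r x\<close> is orthogonal to
  the all-ones vector. By the ground state transform, \<open>z \<bullet> A z - \<mu> (z \<bullet> z)\<close> has contributions from the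
  two nodal edges only, and these are not positive. So \<open>z\<close> is a minimizer and hence an eigenvector.
  At \<open>u1\<close> the eigenvalue equations of \<open>z\<close> and of \<open>r(u1) x\<close> differ only in the term of the
  neighbour \<open>v1\<close>, which contains the jump of \<open>r\<close> and \<open>x(v1)\<close> as factors; the jump is not zero.\<close>

lemma nodal_edge_off_other:
  assumes e1: "nodal x u1 v1" and e2: "nodal x u2 v2"
    and off: "u1 \<noteq> u2" "u1 \<noteq> v2"
  shows "x$v1 = 0"
proof -
  have T1: "{u1, v1} \<in> T" and T2: "{u2, v2} \<in> T" using e1 e2 by (auto simp: nodal_def)
  have ne: "{u1, v1} \<noteq> {u2, v2}" using off by (auto simp: doubleton_eq_iff)
  define D1 D2 where "D1 = side T u1 v1" and "D2 = side T u2 v2"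
  define S1 S2 where "S1 = (\<Sum>a\<in>D1. x$a)" and "S2 = (\<Sum>a\<in>D2. x$a)"
  have "\<mu> * S2 \<noteq> 0"
    using e2 laplacianD(4)[OF A edge_neq[OF T2] T2] side_sum[OF T2]
    unfolding S2_def D2_def by (auto simp: nodal_def)
  then have S2: "S2 \<noteq> 0" by simp
  define r where "r a = of_bool (a \<in> D1) * S2 - of_bool (a \<in> D2) * S1" for a
  define z where "z = (\<chi> a. r a * x$a)"
  have r_eq: "r a = r b" if "{a, b} \<in> T" "{a, b} \<noteq> {u1, v1}" "{a, b} \<noteq> {u2, v2}" for a b
    using same_side[OF T1 that(1,2)] same_side[OF T2 that(1,3)] by (simp add: r_def D1_def D2_def)
  have ind: "(\<Sum>a\<in>UNIV. of_bool (a \<in> D) * x$a) = (\<Sum>a\<in>D. x$a)" for D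
    by (simp add: of_bool_def if_distrib[of "\<lambda>c. c * _"] sum.If_cases cong: if_cong)
  have "1 \<bullet> z = (\<Sum>a\<in>UNIV. S2 * (of_bool (a \<in> D1) * x$a) - S1 * (of_bool (a \<in> D2) * x$a))"
    unfolding inner_vec_def by (intro sum.cong refl) (simp add: z_def r_def algebra_simps)
  also have "\<dots> = S2 * S1 - S1 * S2"
    by (simp only: sum_subtractf sum_distrib_left[symmetric] ind S1_def S2_def)
  finally have z1: "1 \<bullet> z = 0" by simp
  have "0 \<le> A$a$b * (x$a * x$b) * ((r a - r b) * (r a - r b))" for a b
  proof (cases "a \<noteq> b \<and> {a, b} \<in> T")
    case True
    show ?thesis
    proof (cases "x$a * x$b \<le> 0")
      case True
      moreover have "A$a$b \<le> 0"
        using laplacianD(4)[OF A, of a b] \<open>a \<noteq> b \<and> {a, b} \<in> T\<close> by simp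
      ultimately show ?thesis
        by (intro mult_nonneg_nonneg[OF mult_nonpos_nonpos zero_le_square])
    next
      case False
      then have "{a, b} \<noteq> {u1, v1}" "{a, b} \<noteq> {u2, v2}"
        using e1 e2 by (auto simp: nodal_def doubleton_eq_iff mult.commute)
      with True show ?thesis using r_eq[of a b] by simp
    qed
  next
    case False
    then show ?thesis using laplacianD(5)[OF A, of a b] by (cases "a = b") auto
  qed
  then have "z \<bullet> (A *v z) \<le> (\<Sum>a\<in>UNIV. r a * r a * x$a * (A *v x)$a)"
    using ground_state_identity[OF laplacianD(1)[OF A], of r x r] by (simp add: z_def sum_nonneg)
  also have "\<dots> = \<mu> * (z \<bullet> z)"
    by (simp add: eigen z_def inner_vec_def sum_distrib_left mult_ac)
  finally have z: "A *v z = \<mu> *\<^sub>R z"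
    using constrained_minimizer_is_eigenvector[OF laplacianD(1,2)[OF A] min z1] by blast
  have "(\<Sum>b\<in>UNIV. A$u1$b * ((r b - r u1) * x$b)) = (A *v z)$u1 - r u1 * (A *v x)$u1"
    by (simp add: matrix_vector_mult_def z_def sum_distrib_left sum_subtractf algebra_simps)
  also have "\<dots> = 0" unfolding z eigen by (simp add: z_def)
  finally have "(\<Sum>b\<in>UNIV. A$u1$b * ((r b - r u1) * x$b)) = 0" .
  moreover have "A$u1$b * ((r b - r u1) * x$b) = 0" if "b \<noteq> v1" for b
  proof (cases "u1 \<noteq> b \<and> {u1, b} \<in> T")
    case True
    then have "r u1 = r b" using off that by (intro r_eq) (auto simp: doubleton_eq_iff)
    then show ?thesis by simp
  next
    case False
    then show ?thesis using laplacianD(5)[OF A, of u1 b] by (cases "u1 = b") auto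
  qed
  ultimately have "A$u1$v1 * ((r v1 - r u1) * x$v1) = 0"
    by (simp add: sum.remove[of UNIV v1])
  moreover have "A$u1$v1 \<noteq> 0" using laplacianD(4)[OF A edge_neq[OF T1] T1] by simp
  moreover have "r v1 - r u1 = S2"
    using same_side[OF T2 T1 ne] T1 by (simp add: r_def D1_def D2_def)
  ultimately show ?thesis using S2 by simp
qed

text \<open>Both ends of a nodal edge cannot be zero, so one end is on the other edge, and the other end
  is not.\<close>

lemma nodal_edges_share_zero:
  assumes "nodal x u1 v1" "nodal x u2 v2" "{u1, v1} \<noteq> {u2, v2}"
  obtains s where "s \<in> {u1, v1}" "s \<in> {u2, v2}" "x$s = 0"
proof -
  have ne: "x$u1 \<noteq> x$v1" "u1 \<noteq> v1" using assms(1) by (auto simp: nodal_def)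
  note * = nodal_edge_off_other[OF assms(1,2)]
    nodal_edge_off_other[OF nodal_commute[THEN iffD1, OF assms(1)] assms(2)]
  show thesis
  proof (cases "u1 \<in> {u2, v2}")
    case True
    then have "v1 \<notin> {u2, v2}" using ne(2) assms(3) by auto
    then show ?thesis using that[of u1] True *(2) by auto
  next
    case False
    then have "x$v1 = 0" using *(1) by auto
    then show ?thesis using that[of v1] *(2) ne(1) by auto
  qed
qed

text \<open>If \<open>x\<close> keeps its sign on the side of \<open>v\<close>, then the sum of \<open>x\<close> over that side has this sign, and by
  \<open>side_sum\<close> so has the increase of \<open>x\<close> towards \<open>v\<close>.\<close>

lemma growth_into_side:
  assumes uv: "{u, v} \<in> T"
    and "\<And>a b. nodal x a b \<Longrightarrow> a \<notin> side T u v \<or> b \<notin> side T u v"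
  shows "sgn (x$v - x$u) = sgn (x$v)"
proof -
  have "sgn (\<Sum>w\<in>side T u v. x$w) = sgn (x$v)"
  proof (rule sum_sgn_constant)
    show "sgn (x$w) = sgn (x$v)" if "w \<in> side T u v" for w
      by (rule sgn_constant_on_side[OF assms(2) that])
  qed (use uv in auto)
  moreover have "sgn (\<mu> * (\<Sum>w\<in>side T u v. x$w)) = sgn (- A$u$v * (x$v - x$u))"
    by (simp only: side_sum[OF uv])
  ultimately show ?thesis
    using \<mu> laplacianD(4)[OF A edge_neq[OF uv] uv] by (simp add: sgn_mult)
qed

lemma fiedler_like_I_if_zero:
  assumes char: "{k. x$k = 0 \<and> (\<exists>j. {k, j} \<in> T \<and> x$j \<noteq> 0)} = {i}"
    and nod: "\<And>a b. nodal x a b \<Longrightarrow> a = i \<or> b = i"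
  shows "fiedler_like_I T x"
  unfolding fiedler_like_I_def
proof (intro exI conjI allI impI)
  show "{k. x$k = 0 \<and> (\<exists>j. {k, j} \<in> T \<and> x$j \<noteq> 0)} = {i}" by (rule char)
next
  fix p assume p: "graph_path T p \<and> hd p = i"
  have xi: "x$i = 0" using char by blast
  obtain q where q: "p = i # q" using p by (cases p) (auto simp: graph_path_def)
  show "sorted_wrt (<) (values_along x p) \<or> sorted_wrt (>) (values_along x p) \<or> (\<forall>v\<in>set p. x$v = 0)"
  proof (cases "q = []")
    case True
    then show ?thesis using q by simp
  next
    case False
    have pq: "graph_path T q" "i \<notin> set q"
      using p q False by (auto simp: graph_path_def successively_Cons)
    define s where "s = sgn (x$(hd q))"
    have "sgn (x$w) = s" if "w \<in> set q" for w
      unfolding s_def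
    proof (rule sgn_constant_on_side)
      show "w \<in> side T i (hd q)" using path_within_side[OF pq] that by blast
      show "a \<notin> side T i (hd q) \<or> b \<notin> side T i (hd q)" if "nodal x a b" for a b
        using nod[OF that] by auto
    qed
    note sq = this
    have step: "sgn (x$v - x$u) = s" if e: "p = p1 @ u # v # p2" "{u, v} \<in> T" for p1 u v p2
    proof -
      have "i \<notin> side T u v" using path_start_not_in_side[of p p1 u v p2] p e by auto
      then have "sgn (x$v - x$u) = sgn (x$v)" using nod by (intro growth_into_side e) auto
      moreover have "v \<in> set q" using e q by (cases p1) auto
      ultimately show ?thesis using sq by simp
    qed
    have "s = 1 \<or> s = -1 \<or> s = 0" by (simp add: s_def sgn_if)
    then consider "s = 1" | "s = -1" | "s = 0" by blast
    then show ?thesis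
    proof cases
      case 1
      have "successively (\<lambda>u v. x$u < x$v) p"
      proof (rule graph_path_successivelyI[OF conjunct1[OF p]])
        show "x$u < x$v" if "p = p1 @ u # v # p2" "{u, v} \<in> T" for p1 u v p2
          using step[OF that] 1 by (simp add: sgn_1_pos)
      qed
      then show ?thesis by (simp add: successively_map flip: successively_conv_sorted_wrt)
    next
      case 2
      have "successively (\<lambda>u v. x$u > x$v) p"
      proof (rule graph_path_successivelyI[OF conjunct1[OF p]])
        show "x$u > x$v" if "p = p1 @ u # v # p2" "{u, v} \<in> T" for p1 u v p2
          using step[OF that] 2 by (simp add: sgn_1_neg)
      qed
      then show ?thesis by (simp add: successively_map flip: successively_conv_sorted_wrt)
    next
      case 3
      then have "\<forall>v\<in>set p. x$v = 0" using sq xi q by (auto simp: sgn_0_0)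
      then show ?thesis by blast
    qed
  qed
qed

lemma path_growth_off_nodal_edge:
  assumes ij: "{i, j} \<in> T" and nod: "\<And>a b. nodal x a b \<Longrightarrow> {a, b} = {i, j}"
    and p: "graph_path T p" "hd p = i" "j \<notin> set p"
  shows "successively (\<lambda>u v. sgn (x$v - x$u) = sgn (x$i)) p"
proof (rule graph_path_successivelyI[OF p(1)])
  fix p1 u v p2 assume e: "p = p1 @ u # v # p2" "{u, v} \<in> T"
  have "i \<notin> side T u v" using path_start_not_in_side[of p p1 u v p2] p e by auto
  moreover have "{i, j} \<noteq> {u, v}" using e(1) p(3) by (auto simp: doubleton_eq_iff)
  ultimately have "j \<notin> side T u v" using same_side[OF e(2) ij] by blast
  with \<open>i \<notin> side T u v\<close> have "sgn (x$v - x$u) = sgn (x$v)"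
    using nod by (intro growth_into_side e) (metis doubleton_eq_iff)
  moreover have "sgn (x$v) = sgn (x$i)"
  proof (rule sgn_constant_on_side)
    show "v \<in> side T j i" using path_within_side[OF p(1,3)] p(2) e(1) by auto
    show "a \<notin> side T j i \<or> b \<notin> side T j i" if "nodal x a b" for a b
      using nod[OF that] by (auto simp: doubleton_eq_iff)
  qed
  ultimately show "sgn (x$v - x$u) = sgn (x$i)" by simp
qed

lemma fiedler_like_II_if_sign_change:
  assumes ij: "{i, j} \<in> T" "x$i < 0" "0 < x$j"
    and nod: "\<And>a b. nodal x a b \<Longrightarrow> {a, b} = {i, j}"
  shows "fiedler_like_II T x"
  unfolding fiedler_like_II_def
proof (intro exI conjI allI impI)
  have "{k, l} = {i, j}" if "{k, l} \<in> T" "x$k * x$l < 0" for k l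
  proof (rule nod)
    have "x$k \<noteq> x$l" using that(2) by (auto simp: mult_less_0_iff)
    with that show "nodal x k l" by (simp add: nodal_def)
  qed
  moreover have "x$i * x$j < 0" using ij by (intro mult_neg_pos)
  ultimately show "{{k, l} |k l. {k, l} \<in> T \<and> x$k * x$l < 0} = {{i, j}}"
    using ij(1) by blast
  show "x$i < 0" "0 < x$j" using ij by auto
next
  fix p assume p: "graph_path T p \<and> hd p = i \<and> j \<notin> set p"
  have "successively (\<lambda>u v. x$u > x$v) p"
    using path_growth_off_nodal_edge[OF ij(1) nod, of p] p ij(2) by (simp add: sgn_1_neg)
  then show "sorted_wrt (>) (values_along x p)"
    by (simp add: successively_map flip: successively_conv_sorted_wrt)
next
  fix p assume p: "graph_path T p \<and> hd p = j \<and> i \<notin> set p"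
  have "successively (\<lambda>u v. x$u < x$v) p"
    using path_growth_off_nodal_edge[of j i p] nod p ij by (simp add: sgn_1_pos insert_commute)
  then show "sorted_wrt (<) (values_along x p)"
    by (simp add: successively_map flip: successively_conv_sorted_wrt)
qed

text \<open>A path from a positive to a nonpositive value contains a nodal edge. If some nodal edge has
  ends of opposite signs, it has no zero vertex to share and is the only nodal edge (Type II).
  Otherwise each nodal edge has one zero end, and all of them share it (Type I).\<close>

theorem eigenvector_fiedler_like:
  assumes "x \<noteq> 0"
  shows "fiedler_like T x"
proof -
  have x1: "1 \<bullet> x = 0" using laplacian_eigenvector_sum[OF A eigen] \<mu> by simp
  then have sum0: "(\<Sum>a\<in>UNIV. x$a) = 0" by (simp add: inner_vec_def)
  obtain a where a: "x$a > 0"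
  proof (rule ccontr)
    assume "\<not> thesis"
    then have "\<forall>a. x$a \<le> 0" using that not_le by blast
    then have "\<forall>a. x$a = 0"
      using sum0 sum_nonneg_eq_0_iff[of UNIV "\<lambda>a. - x$a"] by (simp add: sum_negf)
    with assms show False by (simp add: vec_eq_iff)
  qed
  obtain b where b: "x$b \<le> 0"
  proof (rule ccontr)
    assume "\<not> thesis"
    then have "\<forall>a. x$a > 0" using that not_le by blast
    then have "(\<Sum>a\<in>UNIV. x$a) > 0" by (intro sum_pos) auto
    with sum0 show False by simp
  qed
  obtain p where p: "graph_path T p" "hd p = a" "last p = b" using path_exists .
  have "p \<noteq> []" using p(1) by (simp add: graph_path_def)
  moreover have "hd p \<in> {c. x$c > 0}" "last p \<notin> {c. x$c > 0}" using a b p by auto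
  ultimately obtain p1 c i p2 where q: "p = p1 @ c # i # p2" "x$c > 0" "x$i \<le> 0"
    by (rule path_leaves_set) auto
  have ci: "{c, i} \<in> T" using p(1) q(1) by (auto simp: graph_path_def successively_append_iff)
  then have nci: "nodal x c i" using q by (auto simp: nodal_def mult_le_0_iff)
  show ?thesis
  proof (cases "\<exists>k l. {k, l} \<in> T \<and> x$k < 0 \<and> 0 < x$l")
    case True
    then obtain k l where kl: "{k, l} \<in> T" "x$k < 0" "0 < x$l" by blast
    then have n: "nodal x k l" by (auto simp: nodal_def mult_le_0_iff)
    have "{a, b} = {k, l}" if ab: "nodal x a b" for a b
    proof (rule ccontr)
      assume "{a, b} \<noteq> {k, l}"
      then obtain s where "s \<in> {k, l}" "x$s = 0"
        using nodal_edges_share_zero[OF n ab] by metis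
      with kl show False by auto
    qed
    then show ?thesis
      using fiedler_like_II_if_sign_change[OF kl] x1 by (simp add: fiedler_like_def)
  next
    case False
    then have xi: "x$i = 0" using ci q(2,3) by (metis insert_commute less_eq_real_def)
    have char: "k = i" if k: "x$k = 0" "{k, j} \<in> T" "x$j \<noteq> 0" for k j
    proof (cases "{k, j} = {c, i}")
      case True
      then show ?thesis using k q(2) by (auto simp: doubleton_eq_iff)
    next
      case False
      have "nodal x k j" using k by (auto simp: nodal_def)
      from nodal_edges_share_zero[OF this nci False]
      obtain s where "s \<in> {k, j}" "s \<in> {c, i}" "x$s = 0" .
      then show ?thesis using k q(2) by auto
    qed
    have "fiedler_like_I T x"
    proof (rule fiedler_like_I_if_zero)
      show "{k. x$k = 0 \<and> (\<exists>j. {k, j} \<in> T \<and> x$j \<noteq> 0)} = {i}"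
      proof (intro equalityI subsetI)
        fix k assume "k \<in> {k. x$k = 0 \<and> (\<exists>j. {k, j} \<in> T \<and> x$j \<noteq> 0)}"
        then show "k \<in> {i}" using char by blast
      next
        fix k assume "k \<in> {i}"
        then show "k \<in> {k. x$k = 0 \<and> (\<exists>j. {k, j} \<in> T \<and> x$j \<noteq> 0)}"
          using xi ci q(2) by (auto simp: insert_commute intro!: exI[of _ c])
      qed
      fix a b assume n: "nodal x a b"
      then have ab: "{a, b} \<in> T" "{b, a} \<in> T" "x$a \<noteq> x$b" "x$a * x$b \<le> 0"
        by (auto simp: nodal_def insert_commute)
      then have "x$a = 0 \<or> x$b = 0"
        using False by (metis linorder_neqE_linordered_idom mult_neg_neg mult_pos_pos not_le)
      then show "a = i \<or> b = i" using ab char[of a b] char[of b a] by auto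
    qed
    then show ?thesis using x1 by (simp add: fiedler_like_def)
  qed
qed

end

section \<open>Fiedler-like vectors are Fiedler vectors\<close>

context tree
begin

lemma sum_side_swap:
  fixes f :: "'v \<Rightarrow> real"
  assumes "{u, v} \<in> T" "(\<Sum>a\<in>UNIV. f a) = 0"
  shows "(\<Sum>a\<in>side T v u. f a) = - (\<Sum>a\<in>side T u v. f a)"
  using sum.union_disjoint[of "side T u v" "- side T u v" f] assms
  by (simp add: side_swap)

lemma sum_over_sides:
  fixes f :: "'v \<Rightarrow> real"
  shows "(\<Sum>v | {u, v} \<in> T. \<Sum>a\<in>side T u v. f a) = (\<Sum>a\<in>UNIV - {u}. f a)"
proof -
  have "(\<Union>v\<in>{v. {u, v} \<in> T}. side T u v) = UNIV - {u}"
    using sides_cover[of _ u] by auto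
  then show ?thesis
    by (subst sum.UNION_disjoint[symmetric]) (auto dest: sides_disjoint)
qed

text \<open>By \<open>cut_flow\<close> the equation \<open>A g = m\<close> prescribes the weight of each edge \<open>uv\<close>: it is the sum of
  \<open>m\<close> over one side, divided by the difference of \<open>g\<close>. This is a symmetric choice because the sums
  over the two sides are opposite, and it solves the equation at \<open>u\<close> because the sides at \<open>u\<close>
  partition the other vertices. Positivity is required for one orientation of each edge only, away
  from an arbitrary root \<open>i\<close>.\<close>

lemma laplacian_with_prescribed_image:
  fixes g m :: "real^'v"
  assumes m0: "(\<Sum>a\<in>UNIV. m$a) = 0"
    and out: "\<And>u v. {u, v} \<in> T \<Longrightarrow> i \<notin> side T u v \<Longrightarrow> (g$v - g$u) * (\<Sum>a\<in>side T u v. m$a) > 0"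
  obtains A where "A \<in> weighted_laplacians T" "A *v g = m"
proof -
  define w where "w u v = (\<Sum>a\<in>side T u v. m$a) / (g$v - g$u)" for u v
  have pos: "(g$v - g$u) * (\<Sum>a\<in>side T u v. m$a) > 0" if uv: "{u, v} \<in> T" for u v
  proof (cases "i \<in> side T u v")
    case True
    then have "i \<notin> side T v u" using side_swap[OF uv] by auto
    with uv have "(g$u - g$v) * (\<Sum>a\<in>side T v u. m$a) > 0" by (intro out) (auto simp: insert_commute)
    then show ?thesis unfolding sum_side_swap[OF uv m0] by (simp add: algebra_simps)
  next
    case False
    then show ?thesis by (rule out[OF uv])
  qed
  have w_pos: "w u v > 0" if "{u, v} \<in> T" for u v
    using pos[OF that] by (auto simp: w_def zero_less_divide_iff zero_less_mult_iff)
  have w_sym: "w v u = w u v" if "{u, v} \<in> T" for u v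
    unfolding w_def sum_side_swap[OF that m0]
    by (metis minus_diff_eq minus_divide_divide minus_minus)
  define A :: "real^'v^'v" where "A = (\<chi> a b. if a = b then \<Sum>c | {a, c} \<in> T. w a c
    else if {a, b} \<in> T then - w a b else 0)"
  have Ax: "(A *v x)$a = (\<Sum>c | {a, c} \<in> T. w a c * (x$a - x$c))" for x a
  proof -
    have "(A *v x)$a = A$a$a * x$a + (\<Sum>b\<in>UNIV - {a}. A$a$b * x$b)"
      by (simp add: matrix_vector_mult_def sum.remove[of UNIV a])
    also have "(\<Sum>b\<in>UNIV - {a}. A$a$b * x$b) = (\<Sum>c | {a, c} \<in> T. - w a c * x$c)"
      by (rule sum.mono_neutral_cong_right) (auto simp: A_def dest: edge_neq)
    also have "A$a$a * x$a = (\<Sum>c | {a, c} \<in> T. w a c * x$a)"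
      by (simp add: A_def sum_distrib_right)
    finally show ?thesis
      by (simp add: right_diff_distrib sum_subtractf sum_negf)
  qed
  have "A \<in> weighted_laplacians T"
    unfolding weighted_laplacians_def
  proof (intro CollectI conjI allI impI)
    show "transpose A = A"
      by (auto simp: vec_eq_iff transpose_def A_def insert_commute w_sym)
    show "A *v 1 = 0" by (simp add: vec_eq_iff Ax)
    show "if {a, b} \<in> T then A$a$b < 0 else A$a$b = 0" if "a \<noteq> b" for a b
      using that w_pos[of a b] by (simp add: A_def)
  qed
  moreover have "A *v g = m"
  proof -
    have "w a c * (g$a - g$c) = - (\<Sum>b\<in>side T a c. m$b)" if "{a, c} \<in> T" for a c
    proof -
      have "w a c * (g$c - g$a) = (\<Sum>b\<in>side T a c. m$b)"
        using pos[OF that] by (auto simp: w_def)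
      then show ?thesis by (simp add: algebra_simps)
    qed
    then have "(A *v g)$a = - (\<Sum>b\<in>UNIV - {a}. m$b)" for a
      by (simp add: Ax sum_negf sum_over_sides)
    also have "- (\<Sum>b\<in>UNIV - {a}. m$b) = m$a" for a
      using m0 by (simp add: sum.remove[of UNIV a])
    finally show ?thesis by (simp add: vec_eq_iff)
  qed
  ultimately show thesis using that by blast
qed

text \<open>If \<open>A h = h\<close> where \<open>h\<close> does not vanish, the ground state transform bounds the Rayleigh
  quotient of \<open>r h\<close> from below by \<open>1\<close>, provided that \<open>r\<close> is equal at both ends of every edge where
  \<open>h\<close> changes sign.\<close>

lemma ground_state_bound:
  assumes A: "A \<in> weighted_laplacians T"
    and diag: "\<And>a. h$a * (A *v h)$a = h$a * h$a"
    and edge: "\<And>a b. {a, b} \<in> T \<Longrightarrow> 0 \<le> h$a * h$b \<or> r a = r b"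
    and z: "\<And>a. z$a = r a * h$a"
  shows "z \<bullet> z \<le> z \<bullet> (A *v z)"
proof -
  have zr: "z = (\<chi> a. r a * h$a)" using z by (simp add: vec_eq_iff)
  have "A$a$b * (h$a * h$b) * ((r a - r b) * (r a - r b)) \<le> 0" for a b
  proof (cases "a \<noteq> b \<and> {a, b} \<in> T")
    case True
    show ?thesis
    proof (cases "r a = r b")
      case False
      with True edge have "0 \<le> h$a * h$b" by blast
      moreover have "A$a$b \<le> 0" using laplacianD(4)[OF A, of a b] True by simp
      ultimately show ?thesis
        by (intro mult_nonpos_nonneg[OF mult_nonpos_nonneg zero_le_square])
    qed simp
  next
    case False
    then show ?thesis using laplacianD(5)[OF A, of a b] by (cases "a = b") auto
  qed
  then have "(\<Sum>a\<in>UNIV. r a * r a * h$a * (A *v h)$a) \<le> z \<bullet> (A *v z)"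
    using ground_state_identity[OF laplacianD(1)[OF A], of r h r]
    by (simp add: zr sum_nonpos)
  moreover have "z \<bullet> z = (\<Sum>a\<in>UNIV. r a * r a * h$a * (A *v h)$a)"
    unfolding inner_vec_def
  proof (rule sum.cong)
    fix a
    have "z$a \<bullet> z$a = r a * r a * (h$a * h$a)" by (simp add: z)
    then show "z$a \<bullet> z$a = r a * r a * h$a * (A *v h)$a" unfolding diag[symmetric] by simp
  qed simp
  ultimately show ?thesis by simp
qed

text \<open>For \<open>w\<close> orthogonal to the all-ones vector, subtracting a constant keeps the form
  \<open>w \<bullet> A w\<close> and does not decrease the norm. Hence the bound \<open>1\<close> on the Rayleigh quotient need only be
  shown after a shift, which will be chosen to produce a zero where \<open>x\<close> has its sign change.\<close>

lemma fiedler_vectorI: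
  assumes A: "A \<in> weighted_laplacians T" and x: "A *v x = x" "x \<noteq> 0"
    and shift: "\<And>w. \<exists>c. (w - c *\<^sub>R 1) \<bullet> (w - c *\<^sub>R 1) \<le> (w - c *\<^sub>R 1) \<bullet> (A *v (w - c *\<^sub>R 1))"
  shows "fiedler_vector T x"
proof -
  have x1: "1 \<bullet> x = 0" using laplacian_eigenvector_sum[OF A, of x 1] x(1) by simp
  have "1 * (w \<bullet> w) \<le> w \<bullet> (A *v w)" if w: "1 \<bullet> w = 0" for w
  proof -
    obtain c where c: "(w - c *\<^sub>R 1) \<bullet> (w - c *\<^sub>R 1) \<le> (w - c *\<^sub>R 1) \<bullet> (A *v (w - c *\<^sub>R 1))"
      using shift by blast
    have "w \<bullet> w \<le> w \<bullet> w + (c *\<^sub>R 1) \<bullet> (c *\<^sub>R (1::real^'v))"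
      using inner_ge_zero[of "c *\<^sub>R (1::real^'v)"] by linarith
    also have "\<dots> = (w - c *\<^sub>R 1) \<bullet> (w - c *\<^sub>R 1)"
      using w by (simp add: inner_diff_left inner_diff_right inner_commute)
    also have "\<dots> \<le> (w - c *\<^sub>R 1) \<bullet> (A *v w)"
      using c by (simp add: matrix_vector_mult_diff_distrib matrix_vector_mult_scaleR laplacianD(2)[OF A])
    also have "\<dots> = w \<bullet> (A *v w)"
      using symmetric_inner[OF laplacianD(1)[OF A], of 1 w] laplacianD(2)[OF A]
      by (simp add: inner_diff_left)
    finally show ?thesis by simp
  qed
  then have "eigenvalue_nth 2 A = 1"
    using eigenvalue_2_eqI[OF A x(2) x1, of 1] x(1) by simp
  moreover have "CARD('v) \<ge> 2"
  proof (rule ccontr)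
    assume "\<not> CARD('v) \<ge> 2"
    then have "card (UNIV :: 'v set) \<le> Suc 0" by simp
    then have *: "b = a" for a b :: 'v by (simp add: card_le_Suc0_iff_eq)
    have "x$a = 0" for a
    proof -
      have "(\<Sum>b\<in>UNIV. x$b) = (\<Sum>b\<in>{a}. x$b)"
        using * by (intro sum.cong) auto
      then show ?thesis using x1 by (simp add: inner_vec_def)
    qed
    with x(2) show False by (simp add: vec_eq_iff)
  qed
  ultimately show ?thesis
    unfolding fiedler_vector_def is_eigenvector_def using x by (auto intro!: bexI[OF _ A])
qed

text \<open>The distance from \<open>i\<close> to \<open>v\<close>, counted as the number of edges that separate the two, each taken
  in its orientation away from \<open>i\<close>. In this form the step along an edge follows from
  \<open>same_side\<close>.\<close>

definition depth :: "'v \<Rightarrow> 'v \<Rightarrow> nat" where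
  "depth i v = card {(a, b). {a, b} \<in> T \<and> i \<notin> side T a b \<and> v \<in> side T a b}"

lemma depth_step:
  assumes uv: "{u, v} \<in> T" and i: "i \<notin> side T u v"
  shows "depth i v = Suc (depth i u)"
proof -
  have "{(a, b). {a, b} \<in> T \<and> i \<notin> side T a b \<and> v \<in> side T a b}
      = insert (u, v) {(a, b). {a, b} \<in> T \<and> i \<notin> side T a b \<and> u \<in> side T a b}" (is "?V = insert _ ?U")
  proof (intro set_eqI, clarify)
    fix a b
    consider "(a, b) = (u, v)" | "(a, b) = (v, u)" | "{a, b} \<noteq> {u, v}" by (auto simp: doubleton_eq_iff)
    then show "(a, b) \<in> ?V \<longleftrightarrow> (a, b) \<in> insert (u, v) ?U"
    proof cases
      case 1
      then show ?thesis using uv i by simp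
    next
      case 2
      then show ?thesis using side_swap[OF uv] i edge_neq[OF uv] by auto
    next
      case 3
      then have "{a, b} \<in> T \<Longrightarrow> v \<in> side T a b \<longleftrightarrow> u \<in> side T a b" using same_side[of a b u v] uv by auto
      with 3 show ?thesis by auto
    qed
  qed
  moreover have "(u, v) \<notin> ?U" by simp
  ultimately show ?thesis unfolding depth_def by simp
qed

lemma depth_pos:
  assumes "v \<noteq> i"
  shows "depth i v > 0"
proof -
  obtain b where "{i, b} \<in> T" "v \<in> side T i b" using sides_cover[OF assms] .
  then have "{(a, b). {a, b} \<in> T \<and> i \<notin> side T a b \<and> v \<in> side T a b} \<noteq> {}"
    using not_in_side[of i b] by blast
  then show ?thesis unfolding depth_def card_gt_0_iff by simp
qed

lemma type_I_outward:
  assumes xi: "x$i = 0"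
    and paths: "\<And>p. graph_path T p \<Longrightarrow> hd p = i \<Longrightarrow> sorted_wrt (<) (values_along x p) \<or>
        sorted_wrt (>) (values_along x p) \<or> (\<forall>v\<in>set p. x$v = 0)"
    and uv: "{u, v} \<in> T" "i \<notin> side T u v"
  shows "sgn (x$v - x$u) = sgn (x$v)" and "x$u = 0 \<or> sgn (x$u) = sgn (x$v)"
proof -
  obtain p p1 p2 where p: "graph_path T p" "hd p = i" "p = p1 @ u # v # p2"
    using path_through_edge[OF uv side_root[OF uv(1)]] by metis
  have "sgn (x$v - x$u) = sgn (x$v) \<and> (x$u = 0 \<or> sgn (x$u) = sgn (x$v))"
    using paths[OF p(1,2)]
  proof (elim disjE)
    assume "sorted_wrt (<) (values_along x p)"
    then have "x$u < x$v" "x$i \<le> x$u"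
      using p(2,3) by (auto simp: sorted_wrt_append hd_append split: if_splits) (cases p1; auto)
    with xi show ?thesis by (auto simp: sgn_if)
  next
    assume "sorted_wrt (>) (values_along x p)"
    then have "x$u > x$v" "x$i \<ge> x$u"
      using p(2,3) by (auto simp: sorted_wrt_append hd_append split: if_splits) (cases p1; auto)
    with xi show ?thesis by (auto simp: sgn_if)
  next
    assume "\<forall>v\<in>set p. x$v = 0"
    with p(3) show ?thesis by auto
  qed
  then show "sgn (x$v - x$u) = sgn (x$v)" "x$u = 0 \<or> sgn (x$u) = sgn (x$v)" by auto
qed

text \<open>The eigenvalue equation of \<open>x\<close> leaves the weights on the branches where \<open>x\<close> vanishes free, and
  small weights there would create a smaller eigenvalue. The auxiliary vector \<open>h\<close> fixes them: it is
  \<open>\<bar>x\<bar>\<close> on the other branches and the distance from \<open>i\<close> on these, so that it is zero at \<open>i\<close>,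
  positive elsewhere and increases away from \<open>i\<close>. The weights are those for which \<open>A h = h\<close> off \<open>i\<close>.
  On each branch \<open>x\<close> is \<open>h\<close>, \<open>-h\<close> or zero, so \<open>A x = x\<close> off \<open>i\<close>, and at \<open>i\<close> because both sides sum to
  zero. A vector that vanishes at \<open>i\<close> is a multiple \<open>r h\<close>, so the bound applies after
  shifting by the value at \<open>i\<close>.\<close>

lemma fiedler_vector_if_type_I:
  assumes x1: "1 \<bullet> x = 0" and I: "fiedler_like_I T x"
  shows "fiedler_vector T x"
proof -
  obtain i where char: "{k. x$k = 0 \<and> (\<exists>j. {k, j} \<in> T \<and> x$j \<noteq> 0)} = {i}"
    and paths: "\<And>p. graph_path T p \<Longrightarrow> hd p = i \<Longrightarrow> sorted_wrt (<) (values_along x p) \<or>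
        sorted_wrt (>) (values_along x p) \<or> (\<forall>v\<in>set p. x$v = 0)"
    using I unfolding fiedler_like_I_def by auto
  have "i \<in> {k. x$k = 0 \<and> (\<exists>j. {k, j} \<in> T \<and> x$j \<noteq> 0)}" unfolding char by simp
  then have xi: "x$i = 0" and "x \<noteq> 0" by (auto simp: vec_eq_iff)
  have outward: "sgn (x$v - x$u) = sgn (x$v)" "x$u = 0 \<or> sgn (x$u) = sgn (x$v)"
    if "{u, v} \<in> T" "i \<notin> side T u v" for u v
    by (rule type_I_outward[OF xi paths that]; assumption)+
  have zero: "x$v = 0" if "{u, v} \<in> T" "x$u = 0" "u \<noteq> i" for u v
    using char that by blast
  have sgn_eq: "sgn (x$v) = sgn (x$u)" if uv: "{u, v} \<in> T" "u \<noteq> i" "v \<noteq> i" for u v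
  proof (cases "i \<in> side T u v")
    case False
    then show ?thesis using outward(2)[OF uv(1)] zero[OF uv(1)] uv by auto
  next
    case True
    then have "i \<notin> side T v u" "{v, u} \<in> T" using side_swap[OF uv(1)] uv(1) by (auto simp: insert_commute)
    then show ?thesis using outward(2)[of v u] zero[of v u] uv by auto
  qed
  define h :: "real^'v" where
    "h = (\<chi> v. if v = i then 0 else if x$v = 0 then real (depth i v) else \<bar>x$v\<bar>)"
  \<comment> \<open>the image of \<open>h\<close>, whose entry at \<open>i\<close> is forced by the zero column sums of a Laplacian\<close>
  define m :: "real^'v" where
    "m = (\<chi> v. if v = i then - (\<Sum>a\<in>UNIV - {i}. h$a) else h$v)"
  have hi: "h$i = 0" by (simp add: h_def)
  have h_pos: "h$v > 0" if "v \<noteq> i" for v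
    using depth_pos[OF that] that by (simp add: h_def)
  have h_nonneg: "h$v \<ge> 0" for v using h_pos[of v] hi by (cases "v = i") auto
  have "h$u < h$v" if uv: "{u, v} \<in> T" "i \<notin> side T u v" for u v
  proof -
    have v: "v \<noteq> i" using uv by auto
    show ?thesis
    proof (cases "u = i")
      case True
      then show ?thesis using hi h_pos[OF v] by simp
    next
      case False
      then have s: "sgn (x$v) = sgn (x$u)" "sgn (x$v - x$u) = sgn (x$v)"
        using sgn_eq v uv outward(1)[OF uv] by auto
      then show ?thesis
        using False v depth_step[OF uv] by (auto simp: h_def sgn_if split: if_splits)
    qed
  qed
  moreover have "(\<Sum>a\<in>side T u v. m$a) > 0" if uv: "{u, v} \<in> T" "i \<notin> side T u v" for u v
  proof (rule sum_pos)
    show "side T u v \<noteq> {}" using side_root[OF uv(1)] by blast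
    show "0 < m$a" if "a \<in> side T u v" for a
      using that uv(2) h_pos[of a] by (auto simp: m_def)
  qed simp
  ultimately have "(h$v - h$u) * (\<Sum>a\<in>side T u v. m$a) > 0"
    if "{u, v} \<in> T" "i \<notin> side T u v" for u v using that by simp
  moreover have "(\<Sum>a\<in>UNIV. m$a) = 0"
    by (simp add: sum.remove[of UNIV i] m_def)
  ultimately obtain A where A: "A \<in> weighted_laplacians T" "A *v h = m"
    using laplacian_with_prescribed_image by metis
  have off: "(A *v x)$v = x$v" if v: "v \<noteq> i" for v
  proof -
    have signed: "A$v$b * x$b = sgn (x$v) * (A$v$b * h$b)" for b
    proof (cases "b = i \<or> (b \<noteq> v \<and> {v, b} \<notin> T)")
      case True
      then show ?thesis using xi hi laplacianD(5)[OF A(1), of v b] by auto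
    next
      case False
      then have "sgn (x$b) = sgn (x$v)" using sgn_eq[of v b] v by auto
      moreover have "x$b = sgn (x$b) * h$b" using False by (simp add: h_def sgn_mult_abs)
      ultimately show ?thesis by (metis mult.left_commute)
    qed
    have "(A *v x)$v = sgn (x$v) * (A *v h)$v"
      by (simp only: matrix_vector_mult_def vec_lambda_beta sum_distrib_left signed)
    also have "(A *v h)$v = h$v" using v by (simp add: A(2) m_def)
    also have "sgn (x$v) * h$v = x$v" using v by (simp add: h_def sgn_mult_abs)
    finally show ?thesis .
  qed
  have "1 \<bullet> (A *v x) = 1 \<bullet> x"
    using symmetric_inner[OF laplacianD(1)[OF A(1)], of 1 x] laplacianD(2)[OF A(1)] x1 by simp
  then have "(A *v x)$i = x$i"
    using off by (simp add: inner_vec_def sum.remove[of UNIV i])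
  with off have "A *v x = x" by (metis vec_eq_iff)
  moreover have "\<exists>c. (w - c *\<^sub>R 1) \<bullet> (w - c *\<^sub>R 1) \<le> (w - c *\<^sub>R 1) \<bullet> (A *v (w - c *\<^sub>R 1))" for w
  proof
    show "(w - (w$i) *\<^sub>R 1) \<bullet> (w - (w$i) *\<^sub>R 1) \<le> (w - (w$i) *\<^sub>R 1) \<bullet> (A *v (w - (w$i) *\<^sub>R 1))"
    proof (rule ground_state_bound[OF A(1)])
      show "h$a * (A *v h)$a = h$a * h$a" for a
        by (cases "a = i") (auto simp: A(2) m_def hi)
      show "0 \<le> h$a * h$b \<or> (w$a - w$i) / h$a = (w$b - w$i) / h$b" for a b
        using h_nonneg by simp
      (* at i the quotient is a division by zero, but both sides are zero *)
      show "(w - (w$i) *\<^sub>R 1)$a = (w$a - w$i) / h$a * h$a" for a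
        using h_pos[of a] by (cases "a = i") auto
    qed
  qed
  ultimately show ?thesis using fiedler_vectorI A(1) \<open>x \<noteq> 0\<close> by blast
qed

text \<open>A path from \<open>i\<close> through the edge \<open>uv\<close> to \<open>w\<close> either avoids \<open>j\<close>, and then \<open>x\<close> decreases along it
  from the negative value at \<open>i\<close>; or its second vertex is \<open>j\<close>, since it has to cross the edge \<open>ij\<close>,
  and from there on \<open>x\<close> increases from a positive value.\<close>

lemma type_II_outward:
  assumes ij: "{i, j} \<in> T" "x$i < 0" "0 < x$j"
    and pi: "\<And>p. graph_path T p \<Longrightarrow> hd p = i \<Longrightarrow> j \<notin> set p \<Longrightarrow> sorted_wrt (>) (values_along x p)"
    and pj: "\<And>p. graph_path T p \<Longrightarrow> hd p = j \<Longrightarrow> i \<notin> set p \<Longrightarrow> sorted_wrt (<) (values_along x p)"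
    and uv: "{u, v} \<in> T" "i \<notin> side T u v" and w: "w \<in> side T u v"
  shows "(x$v - x$u) * x$w > 0"
proof -
  obtain p p1 p2 where p: "graph_path T p" "hd p = i" "last p = w" "p = p1 @ u # v # p2"
    using path_through_edge[OF uv w] by metis
  have ne: "p \<noteq> []" using p(1) by (simp add: graph_path_def)
  show ?thesis
  proof (cases "j \<in> set p")
    case False
    have s: "sorted_wrt (>) (values_along x p)" using pi[OF p(1,2) False] .
    then have "x$v < x$u" using p(4) by (auto simp: sorted_wrt_append)
    moreover have "x$w \<le> x$i"
      using s p(2,3) ne last_in_set[of "tl p"] by (cases p) (auto split: if_splits intro: less_imp_le)
    then have "x$w < 0" using ij(2) by simp
    ultimately show ?thesis by (simp add: mult_neg_neg)
  next
    case True
    then obtain q1 q2 where q: "p = q1 @ j # q2" by (auto dest: split_list)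
    have "p = (q1 @ [j]) @ q2" using q by simp
    then have q1: "graph_path T (q1 @ [j])" "hd (q1 @ [j]) = i"
      using p graph_path_appendD(1)[of T "q1 @ [j]" q2] by (auto simp: hd_append)
    then obtain r1 r2 where "q1 @ [j] = r1 @ i # j # r2"
      using path_into_side[OF ij(1) q1(1)] ij(1) by auto
    then have "p = r1 @ i # j # (r2 @ q2)" using q by simp
    moreover have "r1 = []"
      using p(1,2) calculation by (cases r1) (auto simp: graph_path_def)
    ultimately obtain r where r: "p = i # j # r" by auto
    have jr: "graph_path T (j # r)" "i \<notin> set (j # r)"
      using p(1) r by (auto simp: graph_path_def)
    have s: "sorted_wrt (<) (values_along x (j # r))" using pj[OF jr(1) _ jr(2)] by simp
    have "x$j \<le> x$w"
      using s p(3) r last_in_set[of r] by (auto split: if_splits intro: less_imp_le)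
    then have "x$w > 0" using ij(3) by simp
    moreover have "x$u < x$v"
    proof (cases p1)
      case Nil
      then show ?thesis using r p(4) ij by simp
    next
      case (Cons a p1')
      then have "j # r = p1' @ u # v # p2" using r p(4) by simp
      then show ?thesis using s by (auto simp: sorted_wrt_append)
    qed
    ultimately show ?thesis by simp
  qed
qed

text \<open>Here \<open>x\<close> has no zeros, and the weights are those for which \<open>A x = x\<close>. The ground state is \<open>x\<close>
  itself, which changes sign on the edge \<open>ij\<close>. The shift makes \<open>w - c\<close> vanish at the same point
  of this edge as \<open>x\<close> when both are interpolated linearly, so that their quotient is equal at both
  ends.\<close>

lemma fiedler_vector_if_type_II:
  assumes x1: "1 \<bullet> x = 0" and II: "fiedler_like_II T x"
  shows "fiedler_vector T x"
proof -
  obtain i j where only: "{{k, l} |k l. {k, l} \<in> T \<and> x$k * x$l < 0} = {{i, j}}"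
    and ij: "x$i < 0" "0 < x$j"
    and pi: "\<And>p. graph_path T p \<Longrightarrow> hd p = i \<Longrightarrow> j \<notin> set p \<Longrightarrow> sorted_wrt (>) (values_along x p)"
    and pj: "\<And>p. graph_path T p \<Longrightarrow> hd p = j \<Longrightarrow> i \<notin> set p \<Longrightarrow> sorted_wrt (<) (values_along x p)"
    using II unfolding fiedler_like_II_def by auto
  have "{i, j} \<in> {{k, l} |k l. {k, l} \<in> T \<and> x$k * x$l < 0}" unfolding only by simp
  then have ijT: "{i, j} \<in> T" by (elim CollectE exE conjE) simp
  have outward: "(x$v - x$u) * x$w > 0"
    if "{u, v} \<in> T" "i \<notin> side T u v" "w \<in> side T u v" for u v w
    using type_II_outward[OF ijT ij _ _ that] pi pj by blast
  have nz: "x$v \<noteq> 0" for v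
  proof (cases "v = i")
    case False
    then obtain c where "{i, c} \<in> T" "v \<in> side T i c" using sides_cover by metis
    then show ?thesis using outward[of i c v] by auto
  qed (use ij in simp)
  have "(x$v - x$u) * (\<Sum>a\<in>side T u v. x$a) > 0" if uv: "{u, v} \<in> T" "i \<notin> side T u v" for u v
    unfolding sum_distrib_left
    using outward[OF uv] uv(1) by (intro sum_pos) (auto dest: side_root)
  then obtain A where A: "A \<in> weighted_laplacians T" "A *v x = x"
    using laplacian_with_prescribed_image[of x i x] x1 by (auto simp: inner_vec_def)
  have "\<exists>c. (w - c *\<^sub>R 1) \<bullet> (w - c *\<^sub>R 1) \<le> (w - c *\<^sub>R 1) \<bullet> (A *v (w - c *\<^sub>R 1))" for w
  proof
    \<comment> \<open>the interpolated value of \<open>w\<close> at the zero of \<open>x\<close> on the edge\<close>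
    define c where "c = (w$i * x$j - w$j * x$i) / (x$j - x$i)"
    have "(w$i - c) * x$j = (w$j - c) * x$i"
      using ij by (simp add: c_def field_simps)
    then have r_eq: "(w$i - c) / x$i = (w$j - c) / x$j"
      using ij by (simp add: field_simps)
    show "(w - c *\<^sub>R 1) \<bullet> (w - c *\<^sub>R 1) \<le> (w - c *\<^sub>R 1) \<bullet> (A *v (w - c *\<^sub>R 1))"
    proof (rule ground_state_bound[OF A(1)])
      show "x$a * (A *v x)$a = x$a * x$a" for a by (simp add: A(2))
      show "(w - c *\<^sub>R 1)$a = (w$a - c) / x$a * x$a" for a using nz by simp
      show "0 \<le> x$a * x$b \<or> (w$a - c) / x$a = (w$b - c) / x$b" if "{a, b} \<in> T" for a b
      proof (cases "0 \<le> x$a * x$b")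
        case False
        then have "x$a * x$b < 0" by simp
        with that have "{a, b} \<in> {{k, l} |k l. {k, l} \<in> T \<and> x$k * x$l < 0}" by blast
        then have "{a, b} = {i, j}" unfolding only by simp
        then show ?thesis using r_eq by (auto simp: doubleton_eq_iff)
      qed simp
    qed
  qed
  moreover have "x \<noteq> 0" using nz by auto
  ultimately show ?thesis using fiedler_vectorI A by blast
qed

end

theorem theorem2p2:
  fixes T :: "'v::finite set set" and x :: "real ^ 'v"
  assumes "is_tree T"
  shows "fiedler_vector T x \<longleftrightarrow> fiedler_like T x"
proof
  interpret tree T using assms by unfold_locales
  assume "fiedler_vector T x"
  then obtain A where card: "CARD('v) \<ge> 2" and A: "A \<in> weighted_laplacians T"
    and x: "x \<noteq> 0" "A *v x = eigenvalue_nth 2 A *\<^sub>R x"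
    by (auto simp: fiedler_vector_def is_eigenvector_def)
  interpret fiedler_pair T A "eigenvalue_nth 2 A" x
    by unfold_locales (rule A x(2) eigenvalue_2_min[OF A card]; assumption?)+
  show "fiedler_like T x" using eigenvector_fiedler_like x(1) .
next
  interpret tree T using assms by unfold_locales
  assume "fiedler_like T x"
  then show "fiedler_vector T x"
    using fiedler_vector_if_type_I fiedler_vector_if_type_II by (auto simp: fiedler_like_def)
qed

end
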